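(* Let $t_0<t_1$ be real numbers, let $X$ be a Banach space, and let $1\le p\le\infty$. For every $\alpha_0>0$, $$\lim_{\alpha\to\alpha_0}\big\|J^\alpha_{t_0,t}-J^{\alpha_0}_{t_0,t}\big\|_{\mathcal{L}(L^p(t_0,t_1;X),L^p(t_0,t_1;X))}=0.$$
   Context: $L^p(t_0,t_1;X)$ is the Bochner-Lebesgue space on $[t_0,t_1]$ with its usual norm. For $\alpha>0$, $J^\alpha_{t_0,t}$ is the bounded linear operator from $L^p(t_0,t_1;X)$ into itself sending $f$ to the (a.e. defined) function $t\mapsto J^\alpha_{t_0,t}f(t):=\frac{1}{\Gamma(\alpha)}\int_{t_0}^t(t-s)^{\alpha-1}f(s)\,ds$ (Bochner integral). $\|\cdot\|_{\mathcal{L}(Y,Y)}$ is the operator norm on bounded linear operators from $Y$ to $Y$. *)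

theory Defs
  imports "HOL-Probability.Essential_Supremum"
begin

text \<open>The library's Bochner integral is restricted to second countable spaces.  For an arbitrary
  Banach space it is set up here with the same approximation by the library's simple Bochner
  integral; Borel measurability is replaced by strong measurability, as it no longer forces the
  function to be essentially separably valued.\<close>

definition strongly_measurable :: "'a measure \<Rightarrow> ('a \<Rightarrow> 'b::real_normed_vector) \<Rightarrow> bool" where
  "strongly_measurable M f \<longleftrightarrow>
     (\<exists>s. (\<forall>i. simple_function M (s i)) \<and> (AE x in M. (\<lambda>i::nat. s i x) \<longlonglongrightarrow> f x))"

definition has_banach_integral ::
    "'a measure \<Rightarrow> ('a \<Rightarrow> 'b::real_normed_vector) \<Rightarrow> 'b \<Rightarrow> bool" where
  "has_banach_integral M f y \<longleftrightarrow> strongly_measurable M f \<and>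
     (\<exists>s. (\<forall>i. Bochner_Integration.simple_bochner_integrable M (s i)) \<and>
          ((\<lambda>i::nat. \<integral>\<^sup>+ x. ennreal (norm (f x - s i x)) \<partial>M) \<longlonglongrightarrow> 0) \<and>
          ((\<lambda>i. Bochner_Integration.simple_bochner_integral M (s i)) \<longlonglongrightarrow> y))"

definition banach_integral :: "'a measure \<Rightarrow> ('a \<Rightarrow> 'b::real_normed_vector) \<Rightarrow> 'b" where
  "banach_integral M f =
     (if \<exists>y. has_banach_integral M f y then THE y. has_banach_integral M f y else 0)"

lemma strongly_measurable_norm_diff:
  assumes "strongly_measurable M f" and u: "simple_function M u"
  obtains h where "h \<in> borel_measurable M" "AE x in M. ennreal (norm (f x - u x)) = h x"
proof -
  from assms obtain s where s: "\<And>i. simple_function M (s i)"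
    and lim: "AE x in M. (\<lambda>i::nat. s i x) \<longlonglongrightarrow> f x"
    unfolding strongly_measurable_def by blast
  from lim obtain N where Nsub: "{x \<in> space M. \<not> (\<lambda>i. s i x) \<longlonglongrightarrow> f x} \<subseteq> N"
    and N: "N \<in> null_sets M"
    by (rule AE_E) (auto intro: null_setsI)
  define s' where "s' i x = indicator (- N) x *\<^sub>R norm (s i x - u x)" for i x
  define g where "g x = indicator (- N) x *\<^sub>R norm (f x - u x)" for x
  have [measurable]: "N \<in> sets M" using N by auto
  have "(\<lambda>x. norm (s i x - u x)) \<in> borel_measurable M" for i
    using simple_function_compose2[OF s u, where h = "\<lambda>a b. norm (a - b)"]
    by (rule borel_measurable_simple_function)
  then have "s' i \<in> borel_measurable M" for i
    unfolding s'_def by measurable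
  moreover have "(\<lambda>i. s' i x) \<longlonglongrightarrow> g x" if "x \<in> space M" for x
  proof (cases "x \<in> N")
    case False
    with Nsub that have "(\<lambda>i. s i x) \<longlonglongrightarrow> f x" by auto
    with False show ?thesis by (auto simp: s'_def g_def intro!: tendsto_intros)
  qed (simp add: s'_def g_def)
  ultimately have "g \<in> borel_measurable M"
    by (rule borel_measurable_LIMSEQ_metric)
  then have "(\<lambda>x. ennreal (g x)) \<in> borel_measurable M" by measurable
  moreover have "AE x in M. ennreal (norm (f x - u x)) = ennreal (g x)"
    using AE_not_in[OF N] by eventually_elim (simp add: g_def)
  ultimately show thesis by (rule that)
qed

lemma has_banach_integral_unique:
  assumes "has_banach_integral M f y" "has_banach_integral M f z"
  shows "y = z"
proof -
  from assms(1) obtain s where s: "\<And>i. Bochner_Integration.simple_bochner_integrable M (s i)"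
    and S: "(\<lambda>i::nat. \<integral>\<^sup>+ x. ennreal (norm (f x - s i x)) \<partial>M) \<longlonglongrightarrow> 0" (is "?S \<longlonglongrightarrow> 0")
    and sy: "(\<lambda>i. Bochner_Integration.simple_bochner_integral M (s i)) \<longlonglongrightarrow> y" (is "?s \<longlonglongrightarrow> y")
    and sm: "strongly_measurable M f"
    unfolding has_banach_integral_def by blast
  from assms(2) obtain t where t: "\<And>i. Bochner_Integration.simple_bochner_integrable M (t i)"
    and T: "(\<lambda>i::nat. \<integral>\<^sup>+ x. ennreal (norm (f x - t i x)) \<partial>M) \<longlonglongrightarrow> 0" (is "?T \<longlonglongrightarrow> 0")
    and tz: "(\<lambda>i. Bochner_Integration.simple_bochner_integral M (t i)) \<longlonglongrightarrow> z" (is "?t \<longlonglongrightarrow> z")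
    unfolding has_banach_integral_def by blast
  have bound: "ennreal (norm (?s i - ?t i)) \<le> ?S i + ?T i" for i
  proof -
    from s t have sf: "simple_function M (s i)" "simple_function M (t i)"
      by (auto elim: simple_bochner_integrable.cases)
    obtain h where h [measurable]: "h \<in> borel_measurable M"
      and fh: "AE x in M. ennreal (norm (f x - s i x)) = h x"
      using strongly_measurable_norm_diff[OF sm sf(1)] by blast
    obtain k where k [measurable]: "k \<in> borel_measurable M"
      and fk: "AE x in M. ennreal (norm (f x - t i x)) = k x"
      using strongly_measurable_norm_diff[OF sm sf(2)] by blast
    have st: "Bochner_Integration.simple_bochner_integrable M (\<lambda>x. s i x - t i x)"
      by (rule simple_bochner_integrable_compose2[where p = "(-)"]) (simp_all add: s t)
    have "ennreal (norm (?s i - ?t i)) = ennreal (norm (Bochner_Integration.simple_bochner_integral M (\<lambda>x. s i x - t i x)))"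
      by (subst simple_bochner_integral_diff[OF s t]) (rule refl)
    also have "\<dots> \<le> ennreal (Bochner_Integration.simple_bochner_integral M (\<lambda>x. norm (s i x - t i x)))"
      by (intro ennreal_leI simple_bochner_integral_norm_bound st)
    also have "\<dots> = (\<integral>\<^sup>+ x. ennreal (norm (s i x - t i x)) \<partial>M)"
      by (intro simple_bochner_integral_eq_nn_integral
          simple_bochner_integrable_compose2[where p = "\<lambda>a b. norm (a - b)"]) (simp_all add: s t)
    also have "\<dots> \<le> (\<integral>\<^sup>+ x. h x + k x \<partial>M)"
    proof (rule nn_integral_mono_AE)
      show "AE x in M. ennreal (norm (s i x - t i x)) \<le> h x + k x"
        using fh fk
      proof eventually_elim
        case (elim x)
        have "norm (s i x - t i x) \<le> norm (f x - s i x) + norm (f x - t i x)"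
          by (metis dual_order.refl norm_diff_triangle_le norm_minus_commute)
        then show ?case
          unfolding elim[symmetric] by (simp flip: ennreal_plus)
      qed
    qed
    also have "\<dots> = (\<integral>\<^sup>+ x. h x \<partial>M) + (\<integral>\<^sup>+ x. k x \<partial>M)"
      by (rule nn_integral_add) auto
    also have "\<dots> = ?S i + ?T i"
      using fh fk by (simp add: nn_integral_cong_AE[OF fh] nn_integral_cong_AE[OF fk])
    finally show ?thesis .
  qed
  have "(\<lambda>i. ennreal (norm (?s i - ?t i))) \<longlonglongrightarrow> ennreal 0"
  proof (rule tendsto_sandwich[where f = "\<lambda>_. 0" and h = "\<lambda>i. ?S i + ?T i"])
    show "(\<lambda>i. ?S i + ?T i) \<longlonglongrightarrow> ennreal 0"
      using tendsto_add[OF S T] by simp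
    show "eventually (\<lambda>i. ennreal (norm (?s i - ?t i)) \<le> ?S i + ?T i) sequentially"
      by (intro always_eventually allI bound)
  qed auto
  then have "(\<lambda>i. norm (?s i - ?t i)) \<longlonglongrightarrow> 0"
    by (simp flip: ennreal_0)
  moreover have "(\<lambda>i. norm (?s i - ?t i)) \<longlonglongrightarrow> norm (y - z)"
    using sy tz by (intro tendsto_intros)
  ultimately have "norm (y - z) = 0"
    using LIMSEQ_unique by blast
  then show ?thesis by simp
qed

lemma has_bochner_integral_imp_banach:
  fixes f :: "'a \<Rightarrow> 'b::{real_normed_vector, second_countable_topology}"
  assumes "has_bochner_integral M f y"
  shows "has_banach_integral M f y"
  using assms
proof cases
  case (1 s)
  obtain F where F: "\<And>i. simple_function M (F i)"
    "\<And>x. x \<in> space M \<Longrightarrow> (\<lambda>i. F i x) \<longlonglongrightarrow> f x"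
    using borel_measurable_implies_sequence_metric[OF 1(1), of 0] by blast
  then have "strongly_measurable M f"
    unfolding strongly_measurable_def by (intro exI[of _ F]) auto
  with 1(2-4) show ?thesis
    unfolding has_banach_integral_def by (intro conjI exI[of _ s] allI)
qed

lemma banach_integral_eq_lebesgue_integral:
  fixes f :: "'a \<Rightarrow> 'b::{real_normed_vector, second_countable_topology}"
  assumes "integrable M f"
  shows "banach_integral M f = integral\<^sup>L M f"
proof -
  have *: "has_banach_integral M f (integral\<^sup>L M f)"
    by (intro has_bochner_integral_imp_banach has_bochner_integral_integrable assms)
  then have "(THE y. has_banach_integral M f y) = integral\<^sup>L M f"
    by (rule the_equality) (rule has_banach_integral_unique[OF _ *])
  with * show ?thesis unfolding banach_integral_def by auto
qed

definition Lp_norm :: "ennreal \<Rightarrow> 'a measure \<Rightarrow> ('a \<Rightarrow> 'b::real_normed_vector) \<Rightarrow> ennreal" where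
  "Lp_norm p M f =
     (if p = \<infinity> then esssup M (\<lambda>x. ennreal (norm (f x)))
      else let I = (\<integral>\<^sup>+ x. ennreal (norm (f x) powr enn2real p) \<partial>M)
           in if I = \<infinity> then \<infinity> else ennreal (enn2real I powr (1 / enn2real p)))"

text \<open>Elements of the space are representatives rather than classes modulo null sets.  Over a
  complete measure such as \<^term>\<open>lebesgue_on {a..b}\<close>, membership and norm do not
  depend on the representative.\<close>

definition Lp_space :: "ennreal \<Rightarrow> 'a measure \<Rightarrow> ('a \<Rightarrow> 'b::real_normed_vector) set" where
  "Lp_space p M = {f. strongly_measurable M f \<and> Lp_norm p M f < \<infinity>}"

text \<open>With values in \<^typ>\<open>ennreal\<close>: it is \<open>\<infinity>\<close> for an operator that is unbounded on
  the unit ball or does not map the unit ball into the space.\<close>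

definition Lp_opnorm ::
    "ennreal \<Rightarrow> 'a measure \<Rightarrow> (('a \<Rightarrow> 'b::real_normed_vector) \<Rightarrow> ('a \<Rightarrow> 'b)) \<Rightarrow> ennreal" where
  "Lp_opnorm p M T =
     (SUP f \<in> {f \<in> Lp_space p M. Lp_norm p M f \<le> 1}.
        if T f \<in> Lp_space p M then Lp_norm p M (T f) else \<infinity>)"

definition frac_integral :: "real \<Rightarrow> real \<Rightarrow> (real \<Rightarrow> 'b::banach) \<Rightarrow> real \<Rightarrow> 'b" where
  "frac_integral \<alpha> t\<^sub>0 f t =
     (1 / Gamma \<alpha>) *\<^sub>R
       banach_integral (lebesgue_on {t\<^sub>0..t}) (\<lambda>s. ((t - s) powr (\<alpha> - 1)) *\<^sub>R f s)"

end

theory Submission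
  imports Defs
begin

text \<open>\<open>J\<^sup>\<alpha>\<close> is convolution, on an interval of length \<open>c\<close> and towards the past only, with the kernel
  \<open>k\<^sub>\<alpha>(u) = u\<^sup>\<alpha>\<^sup>-\<^sup>1 / \<Gamma>(\<alpha>)\<close>.  So \<open>J\<^sup>\<alpha> - J\<^sup>\<alpha>\<^sup>0\<close> is convolution with \<open>k\<^sub>\<alpha> - k\<^sub>\<alpha>\<^sub>0\<close>, and Young's inequality bounds
  its norm on every \<open>L\<^sup>p\<close> by \<open>\<integral>\<^sub>0\<^sup>c |k\<^sub>\<alpha> - k\<^sub>\<alpha>\<^sub>0|\<close> (\<open>Young_inequality_causal_convolution\<close>).  This
  integral tends to \<open>0\<close> by dominated convergence: for \<open>\<alpha>\<close> between \<open>\<alpha>\<^sub>0/2\<close> and \<open>2\<alpha>\<^sub>0\<close> the power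
  \<open>u\<^sup>\<alpha>\<^sup>-\<^sup>1\<close> lies below the sum of the two integrable extreme powers
  (\<open>tendsto_kernel_mass_RL_kernel_diff\<close>).

  The operator norm is infinite unless the operator maps the unit ball into \<open>L\<^sup>p\<close>, so each function
  \<open>J\<^sup>\<alpha> f\<close> is also shown to be strongly measurable (\<open>strongly_measurable_volterra\<close>).  Fubini's theorem
  for real functions gives this when \<open>f\<close> is simple, because then \<open>J\<^sup>\<alpha> f\<close> is a finite sum of
  measurable real functions times fixed vectors.  In general \<open>f\<close> is the limit of simple functions
  \<open>u\<^sub>i\<close> with \<open>|f - u\<^sub>i| \<le> |f|\<close>, dominated convergence gives \<open>J\<^sup>\<alpha> u\<^sub>i \<rightarrow> J\<^sup>\<alpha> f\<close> almost everywhere,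
  and strong measurability survives limits of sequences.  Both the dominated approximation and the
  closure under limits come from one construction, the nearest point in a growing finite part of a
  countable dense set (\<open>nearest_point_approximation\<close>).  It also shows that a strongly measurable
  function with integrable norm has a Bochner integral.

  The singular integral \<open>\<integral> (t - s)\<^sup>\<alpha>\<^sup>-\<^sup>1 f(s) ds\<close> need exist only for almost every \<open>t\<close>, which is why
  the pointwise statements below hold almost everywhere.\<close>


section \<open>Functions that agree almost everywhere, on complete measures\<close>

lemma complete_measure_lebesgue_on:
  assumes "S \<in> sets lebesgue"
  shows "complete_measure (lebesgue_on S)"
proof
  fix A B :: "'a set"
  assume "B \<subseteq> A" "A \<in> null_sets (lebesgue_on S)"
  with assms have "A \<in> null_sets lebesgue" "B \<subseteq> S"
    by (auto simp: null_sets_restrict_space)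
  with \<open>B \<subseteq> A\<close> have "B \<in> sets lebesgue"
    using completion.complete by blast
  with \<open>B \<subseteq> S\<close> assms show "B \<in> sets (lebesgue_on S)"
    by (simp add: sets_restrict_space_iff)
qed

lemma (in complete_measure) measurable_cong_AE:
  assumes "f \<in> measurable M N" "AE x in M. f x = g x" "\<And>x. x \<in> space M \<Longrightarrow> g x \<in> space N"
  shows "g \<in> measurable M N"
proof (rule measurableI)
  fix A assume "A \<in> sets N"
  then show "g -` A \<inter> space M \<in> sets M"
    using assms(2) by (intro in_sets_AE[OF _ measurable_sets[OF assms(1)]]) auto
qed fact

lemma (in complete_measure) borel_measurable_LIMSEQ_AE:
  fixes g :: "'a \<Rightarrow> 'b::metric_space"
  assumes "\<And>i. f i \<in> borel_measurable M" "AE x in M. (\<lambda>i. f i x) \<longlonglongrightarrow> g x"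
  shows "g \<in> borel_measurable M"
proof -
  from assms(2) obtain N where N: "{x \<in> space M. \<not> (\<lambda>i. f i x) \<longlonglongrightarrow> g x} \<subseteq> N"
    "N \<in> null_sets M"
    by (rule AE_E) (auto intro: null_setsI)
  define c where "c = (undefined :: 'b)"
  have [measurable]: "N \<in> sets M" using N by auto
  have "(\<lambda>x. if x \<in> N then c else g x) \<in> borel_measurable M"
  proof (rule borel_measurable_LIMSEQ_metric)
    show "(\<lambda>x. if x \<in> N then c else f i x) \<in> borel_measurable M" for i
      using assms(1) by measurable
    show "(\<lambda>i. if x \<in> N then c else f i x) \<longlonglongrightarrow> (if x \<in> N then c else g x)" if "x \<in> space M" for x
      using N(1) that by auto
  qed
  then show ?thesis
  proof (rule measurable_cong_AE)
    show "AE x in M. (if x \<in> N then c else g x) = g x"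
      using AE_not_in[OF N(2)] by eventually_elim simp
  qed simp
qed


section \<open>Strong measurability\<close>

lemma simple_function_imp_strongly_measurable:
  "simple_function M f \<Longrightarrow> strongly_measurable M f"
  unfolding strongly_measurable_def by (intro exI[of _ "\<lambda>_. f"]) auto

lemma borel_measurable_imp_strongly_measurable:
  fixes f :: "'a \<Rightarrow> 'b::{real_normed_vector, second_countable_topology}"
  assumes "f \<in> borel_measurable M"
  shows "strongly_measurable M f"
proof -
  obtain F where "\<And>i. simple_function M (F i)" "\<And>x. x \<in> space M \<Longrightarrow> (\<lambda>i. F i x) \<longlonglongrightarrow> f x"
    using borel_measurable_implies_sequence_metric[OF assms, of 0] by blast
  then show ?thesis
    unfolding strongly_measurable_def by (intro exI[of _ F]) auto
qed

lemma strongly_measurable_cong_AE: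
  assumes "strongly_measurable M f" "AE x in M. f x = g x"
  shows "strongly_measurable M g"
proof -
  from assms(1) obtain s where "\<And>i. simple_function M (s i)" "AE x in M. (\<lambda>i. s i x) \<longlonglongrightarrow> f x"
    unfolding strongly_measurable_def by blast
  moreover from this(2) assms(2) have "AE x in M. (\<lambda>i. s i x) \<longlonglongrightarrow> g x"
    by eventually_elim simp
  ultimately show ?thesis unfolding strongly_measurable_def by blast
qed

lemma strongly_measurable_compose2:
  assumes "strongly_measurable M f" "strongly_measurable M g"
    and h: "\<And>p. isCont (\<lambda>p. h (fst p) (snd p)) p"
  shows "strongly_measurable M (\<lambda>x. h (f x) (g x))"
proof -
  from assms(1) obtain s where s: "\<And>i. simple_function M (s i)" "AE x in M. (\<lambda>i. s i x) \<longlonglongrightarrow> f x"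
    unfolding strongly_measurable_def by blast
  from assms(2) obtain t where t: "\<And>i. simple_function M (t i)" "AE x in M. (\<lambda>i. t i x) \<longlonglongrightarrow> g x"
    unfolding strongly_measurable_def by blast
  from s(2) t(2) have "AE x in M. (\<lambda>i. h (s i x) (t i x)) \<longlonglongrightarrow> h (f x) (g x)"
  proof eventually_elim
    case (elim x)
    from isCont_tendsto_compose[OF h tendsto_Pair[OF elim]] show ?case by simp
  qed
  moreover have "simple_function M (\<lambda>x. h (s i x) (t i x))" for i
    by (rule simple_function_compose2[OF s(1) t(1)])
  ultimately show ?thesis
    unfolding strongly_measurable_def by (intro exI[of _ "\<lambda>i x. h (s i x) (t i x)"] conjI allI)
qed

lemma strongly_measurable_add:
  "strongly_measurable M f \<Longrightarrow> strongly_measurable M g \<Longrightarrow> strongly_measurable M (\<lambda>x. f x + g x)"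
  by (rule strongly_measurable_compose2[where h = "(+)"]; (assumption | intro continuous_intros))

lemma strongly_measurable_diff:
  "strongly_measurable M f \<Longrightarrow> strongly_measurable M g \<Longrightarrow> strongly_measurable M (\<lambda>x. f x - g x)"
  by (rule strongly_measurable_compose2[where h = "(-)"]; (assumption | intro continuous_intros))

lemma strongly_measurable_scaleR:
  "strongly_measurable M f \<Longrightarrow> strongly_measurable M g \<Longrightarrow> strongly_measurable M (\<lambda>x. f x *\<^sub>R g x)"
  by (rule strongly_measurable_compose2[where h = "\<lambda>u v. u *\<^sub>R v"]; (assumption | intro continuous_intros))

lemma strongly_measurable_const: "strongly_measurable M (\<lambda>_. c)"
  by (simp add: simple_function_imp_strongly_measurable)

lemma strongly_measurable_bounded_linear:
  assumes "bounded_linear T" "strongly_measurable M f"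
  shows "strongly_measurable M (\<lambda>x. T (f x))"
  by (rule strongly_measurable_compose2[where h = "\<lambda>u v. T u", OF assms(2) assms(2)])
     (intro bounded_linear.isCont[OF assms(1)] continuous_intros)

lemma strongly_measurable_sum:
  "finite I \<Longrightarrow> (\<And>i. i \<in> I \<Longrightarrow> strongly_measurable M (f i)) \<Longrightarrow>
    strongly_measurable M (\<lambda>x. \<Sum>i\<in>I. f i x)"
  by (induction I rule: finite_induct) (auto intro: strongly_measurable_const strongly_measurable_add)

lemma strongly_measurable_restrict_space:
  assumes "strongly_measurable M f" "A \<inter> space M \<in> sets M"
  shows "strongly_measurable (restrict_space M A) f"
proof -
  from assms(1) obtain s where s: "\<And>i. simple_function M (s i)" "AE x in M. (\<lambda>i. s i x) \<longlonglongrightarrow> f x"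
    unfolding strongly_measurable_def by blast
  have "simple_function (restrict_space M A) (s i)" for i
    unfolding simple_function_def
  proof (intro conjI ballI)
    show "finite (s i ` space (restrict_space M A))"
      using simple_functionD(1)[OF s(1)]
      by (rule rev_finite_subset) (auto simp: space_restrict_space)
    show "s i -` {v} \<inter> space (restrict_space M A) \<in> sets (restrict_space M A)" for v
      unfolding space_restrict_space sets_restrict_space
      by (rule image_eqI[OF _ simple_functionD(2)[OF s(1), of i "{v}"]]) auto
  qed
  moreover have "AE x in restrict_space M A. (\<lambda>i. s i x) \<longlonglongrightarrow> f x"
    using s(2) by (subst AE_restrict_space_iff[OF assms(2)]) auto
  ultimately show ?thesis unfolding strongly_measurable_def by blast
qed

lemma (in complete_measure) borel_measurable_norm_strongly_measurable:
  fixes f :: "'a \<Rightarrow> 'b::real_normed_vector"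
  assumes "strongly_measurable M f"
  shows "(\<lambda>x. norm (f x)) \<in> borel_measurable M"
proof -
  from assms obtain s where s: "\<And>i. simple_function M (s i)" "AE x in M. (\<lambda>i. s i x) \<longlonglongrightarrow> f x"
    unfolding strongly_measurable_def by blast
  show ?thesis
  proof (rule borel_measurable_LIMSEQ_AE)
    show "(\<lambda>x. norm (s i x)) \<in> borel_measurable M" for i
      by (rule borel_measurable_simple_function[OF simple_function_compose1[OF s(1)]])
    show "AE x in M. (\<lambda>i. norm (s i x)) \<longlonglongrightarrow> norm (f x)"
      using s(2) by eventually_elim (rule tendsto_norm)
  qed
qed

text \<open>Strong measurability splits into two properties that pass to limits: almost all values lie in a
  separable set, and the distances to fixed vectors are measurable real functions.  The next lemma
  is the first property; \<open>nearest_point_approximation\<close> recovers simple functions from the two.\<close>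

lemma strongly_measurable_essentially_separable:
  assumes "strongly_measurable M f"
  obtains D where "countable D" "AE x in M. f x \<in> closure D"
proof -
  from assms obtain s where s: "\<And>i. simple_function M (s i)" "AE x in M. (\<lambda>i. s i x) \<longlonglongrightarrow> f x"
    unfolding strongly_measurable_def by blast
  let ?D = "\<Union>i. s i ` space M"
  show thesis
  proof (rule that)
    show "countable ?D"
      using simple_functionD(1)[OF s(1)] by (auto intro: countable_finite)
    show "AE x in M. f x \<in> closure ?D"
      using s(2) AE_space
    proof eventually_elim
      case (elim x)
      then show ?case
        by (auto simp: closure_sequential intro!: exI[of _ "\<lambda>i. s i x"])
    qed
  qed
qed

text \<open>Enumerate \<open>D\<close>, starting with the extra point \<open>0\<close>, and let \<open>s n x\<close> be the point nearest to \<open>f x\<close>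
  among the first \<open>n + 1\<close>.  Density gives convergence.  Since \<open>0\<close> always competes, the
  error never exceeds \<open>norm (f x)\<close>; this makes \<open>norm (f x)\<close> a dominating function later on.\<close>

lemma nearest_point_approximation:
  fixes f :: "'a \<Rightarrow> 'b::real_normed_vector"
  assumes "countable D" "AE x in M. f x \<in> closure D"
    and meas: "\<And>d. (\<lambda>x. norm (f x - d)) \<in> borel_measurable M"
  obtains s where "\<And>i. simple_function M (s i)" "\<And>i x. norm (f x - s i x) \<le> norm (f x)"
    "AE x in M. (\<lambda>i::nat. s i x) \<longlonglongrightarrow> f x"
proof -
  define e where "e i = (if i = 0 then 0 else from_nat_into (insert 0 D) (i - 1))" for i :: nat
  have e0: "e 0 = 0" by (simp add: e_def)
  have e: "\<exists>i. e i = d" if "d \<in> D" for d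
  proof -
    from that obtain i where "from_nat_into (insert 0 D) i = d"
      using from_nat_into_surj[of "insert 0 D" d] assms(1) by auto
    then have "e (Suc i) = d" by (simp add: e_def)
    then show ?thesis ..
  qed
  define s where "s = rec_nat (\<lambda>x. e 0)
    (\<lambda>n u x. if norm (f x - e (Suc n)) < norm (f x - u x) then e (Suc n) else u x)"
  have s_0: "s 0 = (\<lambda>x. 0)" 
    and s_Suc: "s (Suc n) = (\<lambda>x. if norm (f x - e (Suc n)) < norm (f x - s n x) then e (Suc n) else s n x)" for n
    by (auto simp: s_def e0)
  have dist: "norm (f x - s n x) = (MIN i\<in>{..n}. norm (f x - e i))" for n x
  proof (induction n)
    case (Suc n)
    have "norm (f x - s (Suc n) x) = min (norm (f x - e (Suc n))) (norm (f x - s n x))"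
      by (simp add: s_Suc)
    then show ?case by (simp add: Suc atMost_Suc)
  qed (simp add: s_0 e0)
  have [measurable]: "(\<lambda>x. norm (f x - s n x)) \<in> borel_measurable M" for n
    unfolding dist by (intro borel_measurable_Min) (auto intro: meas)
  have "simple_function M (s n)" for n
  proof (induction n)
    case (Suc n)
    note [measurable] = meas
    have "Measurable.pred M (\<lambda>x. norm (f x - e (Suc n)) < norm (f x - s n x))"
      by measurable
    with Suc show ?case
      unfolding s_Suc by (intro simple_function_If) (auto simp: pred_def)
  qed (simp add: s_0)
  moreover have le: "norm (f x - s n x) \<le> norm (f x - e i)" if "i \<le> n" for n i x
    unfolding dist using that by (intro Min_le) auto
  moreover have "AE x in M. (\<lambda>i. s i x) \<longlonglongrightarrow> f x"
    using assms(2)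
  proof eventually_elim
    case (elim x)
    show ?case
    proof (rule metric_LIMSEQ_I)
      fix r :: real assume "0 < r"
      then obtain d where "d \<in> D" "dist d (f x) < r"
        using elim closure_approachable by blast
      then obtain i where "e i = d" using e by blast
      then have "dist (s n x) (f x) < r" if "n \<ge> i" for n
        using le[OF that, of x] \<open>dist d (f x) < r\<close> by (simp add: dist_norm norm_minus_commute)
      then show "\<exists>no. \<forall>n\<ge>no. dist (s n x) (f x) < r" by blast
    qed
  qed
  ultimately show thesis
    using that[of s] le[of 0] e0 by simp
qed

lemma (in complete_measure) strongly_measurable_approximation:
  fixes f :: "'a \<Rightarrow> 'b::real_normed_vector"
  assumes "strongly_measurable M f"
  obtains s where "\<And>i. simple_function M (s i)" "\<And>i x. norm (f x - s i x) \<le> norm (f x)"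
    "AE x in M. (\<lambda>i::nat. s i x) \<longlonglongrightarrow> f x"
proof -
  obtain D where D: "countable D" "AE x in M. f x \<in> closure D"
    using strongly_measurable_essentially_separable[OF assms] .
  have "(\<lambda>x. norm (f x - d)) \<in> borel_measurable M" for d
    by (intro borel_measurable_norm_strongly_measurable strongly_measurable_diff assms strongly_measurable_const)
  from nearest_point_approximation[OF D this] show thesis
    using that by blast
qed

text \<open>The union of the countable sets attached to the \<open>f i\<close> serves \<open>g\<close>, which replaces the usual
  diagonal argument.\<close>

lemma (in complete_measure) strongly_measurable_LIMSEQ_AE:
  fixes g :: "'a \<Rightarrow> 'b::real_normed_vector"
  assumes "\<And>i. strongly_measurable M (f i)" "AE x in M. (\<lambda>i. f i x) \<longlonglongrightarrow> g x"
  shows "strongly_measurable M g"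
proof -
  have "\<exists>D. countable D \<and> (AE x in M. f i x \<in> closure D)" for i
    using strongly_measurable_essentially_separable[OF assms(1)] by metis
  then obtain D where D: "\<And>i. countable (D i)" "\<And>i. AE x in M. f i x \<in> closure (D i)"
    by metis
  have "countable (\<Union>i. D i)" using D(1) by simp
  moreover have "AE x in M. g x \<in> closure (\<Union>i. D i)"
  proof -
    have "AE x in M. \<forall>i. f i x \<in> closure (D i)"
      using D(2) by (simp add: AE_all_countable)
    with assms(2) show ?thesis
    proof eventually_elim
      case (elim x)
      have "f i x \<in> closure (\<Union>i. D i)" for i
        using elim(2) closure_mono[of "D i" "\<Union>i. D i"] by blast
      with elim(1) show ?case
        by (intro Lim_in_closed_set[of _ _ sequentially "g x"]) auto
    qed
  qed
  moreover have "(\<lambda>x. norm (g x - d)) \<in> borel_measurable M" for d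
  proof (rule borel_measurable_LIMSEQ_AE)
    show "(\<lambda>x. norm (f i x - d)) \<in> borel_measurable M" for i
      by (intro borel_measurable_norm_strongly_measurable strongly_measurable_diff assms strongly_measurable_const)
    show "AE x in M. (\<lambda>i. norm (f i x - d)) \<longlonglongrightarrow> norm (g x - d)"
      using assms(2) by eventually_elim (intro tendsto_intros)
  qed
  ultimately obtain s where "\<And>i. simple_function M (s i)" "AE x in M. (\<lambda>i::nat. s i x) \<longlonglongrightarrow> g x"
    by (rule nearest_point_approximation) blast
  then show ?thesis
    unfolding strongly_measurable_def by blast
qed


section \<open>The Bochner integral in an arbitrary Banach space\<close>

lemma ennreal_LIMSEQ_0_mono:
  fixes f g :: "nat \<Rightarrow> ennreal"
  assumes "\<And>i. f i \<le> g i" "g \<longlonglongrightarrow> 0"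
  shows "f \<longlonglongrightarrow> 0"
proof (rule tendsto_sandwich[OF _ _ tendsto_const assms(2)])
  show "\<forall>\<^sub>F i in sequentially. f i \<le> g i" using assms(1) by simp
qed simp

text \<open>The integral of a simple function depends continuously on its \<open>L\<^sup>1\<close>-distance from \<open>f\<close>.  Two
  approximations of \<open>f\<close> give the Cauchy property of their integrals, and \<open>t = 0\<close> gives the norm
  bound for the integral of \<open>f\<close>.\<close>

lemma (in complete_measure) simple_bochner_integral_dist_le:
  fixes f :: "'a \<Rightarrow> 'b::real_normed_vector"
  assumes f: "strongly_measurable M f"
    and s: "Bochner_Integration.simple_bochner_integrable M s"
    and t: "Bochner_Integration.simple_bochner_integrable M t"
  shows "ennreal (norm (Bochner_Integration.simple_bochner_integral M s - Bochner_Integration.simple_bochner_integral M t))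
    \<le> (\<integral>\<^sup>+ x. norm (f x - s x) \<partial>M) + (\<integral>\<^sup>+ x. norm (f x - t x) \<partial>M)"
proof -
  from s t have sf: "simple_function M s" "simple_function M t"
    by (auto elim: simple_bochner_integrable.cases)
  have [measurable]: "(\<lambda>x. norm (f x - s x)) \<in> borel_measurable M" "(\<lambda>x. norm (f x - t x)) \<in> borel_measurable M"
    by (intro borel_measurable_norm_strongly_measurable strongly_measurable_diff f
        simple_function_imp_strongly_measurable sf)+
  have st: "Bochner_Integration.simple_bochner_integrable M (\<lambda>x. s x - t x)"
    by (rule simple_bochner_integrable_compose2[where p = "(-)"]) (simp_all add: s t)
  have "ennreal (norm (Bochner_Integration.simple_bochner_integral M s - Bochner_Integration.simple_bochner_integral M t))
      = ennreal (norm (Bochner_Integration.simple_bochner_integral M (\<lambda>x. s x - t x)))"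
    by (subst simple_bochner_integral_diff[OF s t]) (rule refl)
  also have "\<dots> \<le> ennreal (Bochner_Integration.simple_bochner_integral M (\<lambda>x. norm (s x - t x)))"
    by (intro ennreal_leI simple_bochner_integral_norm_bound st)
  also have "\<dots> = (\<integral>\<^sup>+ x. norm (s x - t x) \<partial>M)"
    by (intro simple_bochner_integral_eq_nn_integral
        simple_bochner_integrable_compose2[where p = "\<lambda>a b. norm (a - b)"]) (simp_all add: s t)
  also have "\<dots> \<le> (\<integral>\<^sup>+ x. ennreal (norm (f x - s x)) + ennreal (norm (f x - t x)) \<partial>M)"
  proof (rule nn_integral_mono)
    fix x
    have "norm (s x - t x) \<le> norm (f x - s x) + norm (f x - t x)"
      by (metis dual_order.refl norm_diff_triangle_le norm_minus_commute)
    then show "ennreal (norm (s x - t x)) \<le> ennreal (norm (f x - s x)) + ennreal (norm (f x - t x))"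
      by (simp flip: ennreal_plus)
  qed
  also have "\<dots> = (\<integral>\<^sup>+ x. norm (f x - s x) \<partial>M) + (\<integral>\<^sup>+ x. norm (f x - t x) \<partial>M)"
    by (rule nn_integral_add) auto
  finally show ?thesis .
qed

lemma has_banach_integral_cong:
  assumes "has_banach_integral M f y" "\<And>x. x \<in> space M \<Longrightarrow> f x = g x"
  shows "has_banach_integral M g y"
proof -
  have "strongly_measurable M f \<Longrightarrow> strongly_measurable M g"
    using assms(2) by (auto intro: strongly_measurable_cong_AE)
  moreover have "(\<integral>\<^sup>+ x. ennreal (norm (f x - s x)) \<partial>M) = (\<integral>\<^sup>+ x. ennreal (norm (g x - s x)) \<partial>M)" for s
    using assms(2) by (intro nn_integral_cong) simp
  ultimately show ?thesis
    using assms(1) by (simp add: has_banach_integral_def)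
qed

lemma has_banach_integral_zero: "has_banach_integral M (\<lambda>_. 0 :: 'b::real_normed_vector) 0"
proof -
  have "Bochner_Integration.simple_bochner_integrable M (\<lambda>_. 0 :: 'b)"
    by (auto intro: simple_bochner_integrable.intros)
  moreover have "Bochner_Integration.simple_bochner_integral M (\<lambda>_. 0 :: 'b) = 0"
    by (simp add: simple_bochner_integral_def image_constant_conv)
  ultimately show ?thesis
    unfolding has_banach_integral_def
    by (intro conjI exI[of _ "\<lambda>_ _. 0"]) (simp_all add: strongly_measurable_const)
qed

lemma (in complete_measure) has_banach_integral_norm_le:
  assumes "has_banach_integral M f y"
  shows "ennreal (norm y) \<le> (\<integral>\<^sup>+ x. norm (f x) \<partial>M)"
proof -
  from assms obtain s where s: "\<And>i. Bochner_Integration.simple_bochner_integrable M (s i)"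
    and S: "(\<lambda>i::nat. \<integral>\<^sup>+ x. ennreal (norm (f x - s i x)) \<partial>M) \<longlonglongrightarrow> 0"
    and sy: "(\<lambda>i. Bochner_Integration.simple_bochner_integral M (s i)) \<longlonglongrightarrow> y"
    and f: "strongly_measurable M f"
    unfolding has_banach_integral_def by blast
  have zero: "Bochner_Integration.simple_bochner_integrable M (\<lambda>x. 0 :: 'b)"
    by (auto intro: simple_bochner_integrable.intros)
  have zero_integral: "Bochner_Integration.simple_bochner_integral M (\<lambda>x. 0 :: 'b) = 0"
    by (simp add: simple_bochner_integral_def image_constant_conv)
  have "ennreal (norm (Bochner_Integration.simple_bochner_integral M (s i)))
      \<le> (\<integral>\<^sup>+ x. ennreal (norm (f x - s i x)) \<partial>M) + (\<integral>\<^sup>+ x. norm (f x) \<partial>M)" for i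
    using simple_bochner_integral_dist_le[OF f s[of i] zero]
    by (simp add: zero_integral)
  moreover have "(\<lambda>i. (\<integral>\<^sup>+ x. ennreal (norm (f x - s i x)) \<partial>M) + (\<integral>\<^sup>+ x. norm (f x) \<partial>M))
      \<longlonglongrightarrow> 0 + (\<integral>\<^sup>+ x. norm (f x) \<partial>M)"
    by (intro tendsto_add S tendsto_const)
  moreover have "(\<lambda>i. ennreal (norm (Bochner_Integration.simple_bochner_integral M (s i)))) \<longlonglongrightarrow> ennreal (norm y)"
    by (intro tendsto_ennrealI tendsto_norm sy)
  ultimately show ?thesis
    by (metis (no_types, lifting) LIMSEQ_le add_0)
qed

lemma banach_integral_eqI: "has_banach_integral M f y \<Longrightarrow> banach_integral M f = y"
  unfolding banach_integral_def
  by (auto intro!: the_equality intro: has_banach_integral_unique)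

text \<open>The nearest-point approximations have errors dominated by the norm of \<open>f\<close>, so they converge to \<open>f\<close>
  in \<open>L\<^sup>1\<close>; their integrals form a Cauchy sequence, which converges because the space is complete.
  On a finite measure every simple function is integrable.\<close>

lemma (in complete_measure) has_banach_integral_banach_integral:
  fixes f :: "'a \<Rightarrow> 'b::banach"
  assumes "finite_measure M" and f: "strongly_measurable M f" "(\<integral>\<^sup>+ x. norm (f x) \<partial>M) < \<infinity>"
  shows "has_banach_integral M f (banach_integral M f)"
proof -
  obtain s where s: "\<And>i. simple_function M (s i)" "\<And>i x. norm (f x - s i x) \<le> norm (f x)"
    "AE x in M. (\<lambda>i::nat. s i x) \<longlonglongrightarrow> f x"
    by (rule strongly_measurable_approximation[OF f(1)]) blast
  have int: "Bochner_Integration.simple_bochner_integrable M (s i)" for i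
    using s(1) finite_measure.emeasure_finite[OF assms(1)]
    by (intro simple_bochner_integrable.intros) auto
  have [measurable]: "(\<lambda>x. norm (f x)) \<in> borel_measurable M"
    "(\<lambda>x. norm (f x - s i x)) \<in> borel_measurable M" for i
    by (intro borel_measurable_norm_strongly_measurable strongly_measurable_diff f
        simple_function_imp_strongly_measurable s)+
  have "(\<lambda>i. \<integral>\<^sup>+ x. ennreal (norm (f x - s i x)) \<partial>M) \<longlonglongrightarrow> (\<integral>\<^sup>+ x. 0 \<partial>M)"
  proof (rule nn_integral_dominated_convergence[where w = "\<lambda>x. norm (f x)"])
    show "AE x in M. (\<lambda>i. ennreal (norm (f x - s i x))) \<longlonglongrightarrow> 0"
      using s(3)
    proof eventually_elim
      case (elim x)
      have "(\<lambda>i. ennreal (norm (f x - s i x))) \<longlonglongrightarrow> ennreal (norm (f x - f x))"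
        by (intro tendsto_ennrealI tendsto_intros elim)
      then show ?case by simp
    qed
  qed (use f(2) s(2) in auto)
  then have lim: "(\<lambda>i. \<integral>\<^sup>+ x. ennreal (norm (f x - s i x)) \<partial>M) \<longlonglongrightarrow> 0" (is "?d \<longlonglongrightarrow> _")
    by simp
  let ?I = "\<lambda>i. Bochner_Integration.simple_bochner_integral M (s i)"
  have "Cauchy ?I"
  proof (rule metric_CauchyI)
    fix e :: real assume "0 < e"
    then have "0 < ennreal (e / 2)" by simp
    with lim have "\<forall>\<^sub>F i in sequentially. ?d i < ennreal (e / 2)"
      by (rule order_tendstoD(2))
    then obtain N where N: "\<And>i. i \<ge> N \<Longrightarrow> ?d i < ennreal (e / 2)"
      by (auto simp: eventually_sequentially)
    show "\<exists>N. \<forall>m\<ge>N. \<forall>n\<ge>N. dist (?I m) (?I n) < e"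
    proof (intro exI allI impI)
      fix m n assume "N \<le> m" "N \<le> n"
      have "ennreal (dist (?I m) (?I n)) \<le> ?d m + ?d n"
        unfolding dist_norm by (rule simple_bochner_integral_dist_le[OF f(1) int int])
      also have "\<dots> < ennreal (e / 2) + ennreal (e / 2)"
        using N[OF \<open>N \<le> m\<close>] N[OF \<open>N \<le> n\<close>] by (rule add_strict_mono)
      also have "\<dots> = ennreal e"
        using \<open>0 < e\<close> by (simp flip: ennreal_plus)
      finally show "dist (?I m) (?I n) < e"
        using \<open>0 < e\<close> by (simp add: ennreal_less_iff)
    qed
  qed
  then obtain y where "?I \<longlonglongrightarrow> y"
    using Cauchy_convergent convergentD by blast
  with int lim f(1) have "has_banach_integral M f y"
    unfolding has_banach_integral_def by blast
  then show ?thesis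
    by (simp add: banach_integral_eqI)
qed

lemma (in complete_measure) has_banach_integral_bounded_linear:
  fixes f :: "'a \<Rightarrow> 'b::real_normed_vector" and T :: "'b \<Rightarrow> 'c::real_normed_vector"
  assumes T: "bounded_linear T" and "has_banach_integral M f y"
  shows "has_banach_integral M (\<lambda>x. T (f x)) (T y)"
proof -
  interpret T: bounded_linear T by fact
  obtain K where K: "0 < K" "\<And>v. norm (T v) \<le> norm v * K"
    using T.pos_bounded by blast
  from assms(2) obtain s where s: "\<And>i. Bochner_Integration.simple_bochner_integrable M (s i)"
    and S: "(\<lambda>i::nat. \<integral>\<^sup>+ x. ennreal (norm (f x - s i x)) \<partial>M) \<longlonglongrightarrow> 0"
    and sy: "(\<lambda>i. Bochner_Integration.simple_bochner_integral M (s i)) \<longlonglongrightarrow> y"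
    and f: "strongly_measurable M f"
    unfolding has_banach_integral_def by blast
  from s have sf: "simple_function M (s i)" for i
    by (auto elim: simple_bochner_integrable.cases)
  have [measurable]: "(\<lambda>x. norm (f x - s i x)) \<in> borel_measurable M" for i
    by (intro borel_measurable_norm_strongly_measurable strongly_measurable_diff f
        simple_function_imp_strongly_measurable sf)
  have "(\<integral>\<^sup>+ x. ennreal (norm (T (f x) - T (s i x))) \<partial>M) \<le> ennreal K * (\<integral>\<^sup>+ x. ennreal (norm (f x - s i x)) \<partial>M)" for i
  proof -
    have "(\<integral>\<^sup>+ x. ennreal (norm (T (f x) - T (s i x))) \<partial>M) \<le> (\<integral>\<^sup>+ x. ennreal K * ennreal (norm (f x - s i x)) \<partial>M)"
      using K by (intro nn_integral_mono) (simp add: T.diff[symmetric] mult.commute flip: ennreal_mult)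
    then show ?thesis by (simp add: nn_integral_cmult)
  qed
  moreover have "(\<lambda>i. ennreal K * (\<integral>\<^sup>+ x. ennreal (norm (f x - s i x)) \<partial>M)) \<longlonglongrightarrow> 0"
    using ennreal_tendsto_cmult[OF _ S, of "ennreal K"] by simp
  ultimately have "(\<lambda>i. \<integral>\<^sup>+ x. ennreal (norm (T (f x) - T (s i x))) \<partial>M) \<longlonglongrightarrow> 0"
    by (rule ennreal_LIMSEQ_0_mono)
  moreover have "Bochner_Integration.simple_bochner_integrable M (\<lambda>x. T (s i x))" for i
    by (rule simple_bochner_integrable_compose2[where p = "\<lambda>u v. T u", OF _ s s]) simp
  moreover have "(\<lambda>i. Bochner_Integration.simple_bochner_integral M (\<lambda>x. T (s i x))) \<longlonglongrightarrow> T y"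
    using T.tendsto[OF sy] by (simp add: simple_bochner_integral_linear[OF T.linear s])
  ultimately show ?thesis
    unfolding has_banach_integral_def using strongly_measurable_bounded_linear[OF T f]
    by (intro conjI exI[of _ "\<lambda>i x. T (s i x)"]) auto
qed

lemma (in complete_measure) has_banach_integral_add:
  fixes f g :: "'a \<Rightarrow> 'b::real_normed_vector"
  assumes "has_banach_integral M f y" "has_banach_integral M g z"
  shows "has_banach_integral M (\<lambda>x. f x + g x) (y + z)"
proof -
  from assms(1) obtain s where s: "\<And>i. Bochner_Integration.simple_bochner_integrable M (s i)"
    and S: "(\<lambda>i::nat. \<integral>\<^sup>+ x. ennreal (norm (f x - s i x)) \<partial>M) \<longlonglongrightarrow> 0"
    and sy: "(\<lambda>i. Bochner_Integration.simple_bochner_integral M (s i)) \<longlonglongrightarrow> y"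
    and f: "strongly_measurable M f"
    unfolding has_banach_integral_def by blast
  from assms(2) obtain t where t: "\<And>i. Bochner_Integration.simple_bochner_integrable M (t i)"
    and T: "(\<lambda>i::nat. \<integral>\<^sup>+ x. ennreal (norm (g x - t i x)) \<partial>M) \<longlonglongrightarrow> 0"
    and tz: "(\<lambda>i. Bochner_Integration.simple_bochner_integral M (t i)) \<longlonglongrightarrow> z"
    and g: "strongly_measurable M g"
    unfolding has_banach_integral_def by blast
  from s t have sf: "simple_function M (s i)" "simple_function M (t i)" for i
    by (auto elim: simple_bochner_integrable.cases)
  have [measurable]: "(\<lambda>x. norm (f x - s i x)) \<in> borel_measurable M" "(\<lambda>x. norm (g x - t i x)) \<in> borel_measurable M" for i
    by (intro borel_measurable_norm_strongly_measurable strongly_measurable_diff f g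
        simple_function_imp_strongly_measurable sf)+
  have "(\<integral>\<^sup>+ x. ennreal (norm (f x + g x - (s i x + t i x))) \<partial>M)
      \<le> (\<integral>\<^sup>+ x. ennreal (norm (f x - s i x)) \<partial>M) + (\<integral>\<^sup>+ x. ennreal (norm (g x - t i x)) \<partial>M)" for i
  proof -
    have "(\<integral>\<^sup>+ x. ennreal (norm (f x + g x - (s i x + t i x))) \<partial>M)
        \<le> (\<integral>\<^sup>+ x. ennreal (norm (f x - s i x)) + ennreal (norm (g x - t i x)) \<partial>M)"
      by (intro nn_integral_mono) (simp add: norm_diff_triangle_ineq flip: ennreal_plus)
    then show ?thesis by (simp add: nn_integral_add)
  qed
  moreover have "(\<lambda>i. (\<integral>\<^sup>+ x. ennreal (norm (f x - s i x)) \<partial>M) + (\<integral>\<^sup>+ x. ennreal (norm (g x - t i x)) \<partial>M)) \<longlonglongrightarrow> 0"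
    using tendsto_add[OF S T] by simp
  ultimately have "(\<lambda>i. \<integral>\<^sup>+ x. ennreal (norm (f x + g x - (s i x + t i x))) \<partial>M) \<longlonglongrightarrow> 0"
    by (rule ennreal_LIMSEQ_0_mono)
  moreover have "Bochner_Integration.simple_bochner_integrable M (\<lambda>x. s i x + t i x)" for i
    by (rule simple_bochner_integrable_compose2[where p = "(+)", OF _ s t]) simp
  moreover have "(\<lambda>i. Bochner_Integration.simple_bochner_integral M (\<lambda>x. s i x + t i x)) \<longlonglongrightarrow> y + z"
    using tendsto_add[OF sy tz] by (simp add: simple_bochner_integral_add[OF s t])
  ultimately show ?thesis
    unfolding has_banach_integral_def using strongly_measurable_add[OF f g]
    by (intro conjI exI[of _ "\<lambda>i x. s i x + t i x"]) auto
qed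

lemma (in complete_measure) has_banach_integral_diff:
  fixes f g :: "'a \<Rightarrow> 'b::real_normed_vector"
  assumes "has_banach_integral M f y" "has_banach_integral M g z"
  shows "has_banach_integral M (\<lambda>x. f x - g x) (y - z)"
  using has_banach_integral_add[OF assms(1)
      has_banach_integral_bounded_linear[OF bounded_linear_minus[OF bounded_linear_ident] assms(2)]]
  by simp

lemma (in complete_measure) has_banach_integral_sum:
  fixes f :: "'i \<Rightarrow> 'a \<Rightarrow> 'b::real_normed_vector"
  assumes "finite I" "\<And>i. i \<in> I \<Longrightarrow> has_banach_integral M (f i) (y i)"
  shows "has_banach_integral M (\<lambda>x. \<Sum>i\<in>I. f i x) (\<Sum>i\<in>I. y i)"
  using assms
  by (induction I rule: finite_induct) (simp_all add: has_banach_integral_zero has_banach_integral_add)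


section \<open>Causal convolution on an interval\<close>

definition volterra :: "(real \<Rightarrow> real) \<Rightarrow> real \<Rightarrow> (real \<Rightarrow> 'b::banach) \<Rightarrow> real \<Rightarrow> 'b" where
  "volterra k a f t = banach_integral (lebesgue_on {a..t}) (\<lambda>s. k (t - s) *\<^sub>R f s)"

text \<open>The \<open>L\<^sup>1\<close>-norm of \<open>k\<close> on \<open>[0, c]\<close>, as an extended real so that it makes sense for every \<open>k\<close>.\<close>

definition kernel_mass :: "(real \<Rightarrow> real) \<Rightarrow> real \<Rightarrow> ennreal" where
  "kernel_mass k c = (\<integral>\<^sup>+ u. ennreal \<bar>k u\<bar> * indicator {0..c} u \<partial>lborel)"

lemma frac_integral_eq_volterra:
  "frac_integral \<alpha> a f t = (1 / Gamma \<alpha>) *\<^sub>R volterra (\<lambda>u. u powr (\<alpha> - 1)) a f t"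
  by (simp add: frac_integral_def volterra_def)

lemma complete_lebesgue_on_Icc: "complete_measure (lebesgue_on {a..b::real})"
  by (rule complete_measure_lebesgue_on) simp

lemma finite_lebesgue_on_Icc: "finite_measure (lebesgue_on {a..b::real})"
  by (rule finite_measure_lebesgue_on) simp

lemma sigma_finite_lebesgue_on_Icc: "sigma_finite_measure (lebesgue_on {a..b::real})"
  using finite_lebesgue_on_Icc by (rule finite_measure.axioms)

lemma lebesgue_on_Icc_subinterval:
  "t \<le> (b::real) \<Longrightarrow> lebesgue_on {a..t} = restrict_space (lebesgue_on {a..b}) {a..t}"
  by (subst restrict_restrict_space) (auto intro!: arg_cong[where f = lebesgue_on])

lemma borel_measurable_lebesgue_on_subinterval:
  "f \<in> measurable (lebesgue_on {a..b}) N \<Longrightarrow> t \<le> (b::real) \<Longrightarrow> f \<in> measurable (lebesgue_on {a..t}) N"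
  unfolding lebesgue_on_Icc_subinterval by (rule measurable_restrict_space1)

lemma nn_integral_lebesgue_on_subinterval:
  "t \<le> (b::real) \<Longrightarrow>
    (\<integral>\<^sup>+ s. g s \<partial>lebesgue_on {a..t}) = (\<integral>\<^sup>+ s. g s * indicator {a..t} s \<partial>lebesgue_on {a..b})"
  unfolding lebesgue_on_Icc_subinterval
  by (rule nn_integral_restrict_space) (auto simp: sets_restrict_space)

lemma AE_lebesgue_on_subinterval:
  assumes "AE s in lebesgue_on {a..b}. P s" "t \<le> (b::real)"
  shows "AE s in lebesgue_on {a..t}. P s"
  unfolding lebesgue_on_Icc_subinterval[OF assms(2)]
  using assms(1) by (subst AE_restrict_space_iff) (auto simp: sets_restrict_space)

lemma strongly_measurable_lebesgue_on_subinterval: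
  "strongly_measurable (lebesgue_on {a..b}) f \<Longrightarrow> t \<le> (b::real) \<Longrightarrow> strongly_measurable (lebesgue_on {a..t}) f"
  unfolding lebesgue_on_Icc_subinterval
  by (rule strongly_measurable_restrict_space) (auto simp: sets_restrict_space)

lemma borel_measurable_lebesgue_on_Icc:
  "f \<in> measurable borel N \<Longrightarrow> f \<in> measurable (lebesgue_on {a..b::real}) N"
  by (intro measurable_restrict_space1 measurable_completion) simp

lemma measurable_reflected_kernel:
  fixes k :: "real \<Rightarrow> real"
  assumes [measurable]: "k \<in> borel_measurable borel"
  shows "(\<lambda>s. k (t - s)) \<in> borel_measurable (lebesgue_on {a..b::real})"
  by (rule borel_measurable_lebesgue_on_Icc) measurable

lemma strongly_measurable_volterra_integrand:
  fixes k :: "real \<Rightarrow> real"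
  assumes "k \<in> borel_measurable borel" "strongly_measurable (lebesgue_on {a..b}) f" "t \<le> b"
  shows "strongly_measurable (lebesgue_on {a..t}) (\<lambda>s. k (t - s) *\<^sub>R f s)"
  by (intro strongly_measurable_scaleR borel_measurable_imp_strongly_measurable
      measurable_reflected_kernel strongly_measurable_lebesgue_on_subinterval[OF assms(2,3)] assms)

lemma nn_integral_lebesgue_on_Icc_borel:
  assumes "g \<in> borel_measurable borel"
  shows "(\<integral>\<^sup>+ s. g s \<partial>lebesgue_on {a..b::real}) = (\<integral>\<^sup>+ s. g s * indicator {a..b} s \<partial>lborel)"
  by (simp add: nn_integral_restrict_space nn_integral_completion)

lemma nn_integral_reflected_kernel_le:
  fixes k :: "real \<Rightarrow> real"
  assumes [measurable]: "k \<in> borel_measurable borel" and "t \<le> b"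
  shows "(\<integral>\<^sup>+ s. ennreal \<bar>k (t - s)\<bar> \<partial>lebesgue_on {a..t}) \<le> kernel_mass k (b - a)"
proof -
  let ?g = "\<lambda>u. ennreal \<bar>k u\<bar> * indicator {0..t - a} u"
  have "(\<integral>\<^sup>+ s. ennreal \<bar>k (t - s)\<bar> \<partial>lebesgue_on {a..t}) = (\<integral>\<^sup>+ s. ennreal \<bar>k (t - s)\<bar> * indicator {a..t} s \<partial>lborel)"
    by (rule nn_integral_lebesgue_on_Icc_borel) measurable
  also have "\<dots> = (\<integral>\<^sup>+ s. ?g (t + (- 1) * s) \<partial>lborel)"
    by (intro nn_integral_cong) (auto simp: indicator_def)
  also have "\<dots> = (\<integral>\<^sup>+ u. ?g u \<partial>lborel)"
    by (subst nn_integral_real_affine[of ?g "-1" t]) auto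
  also have "\<dots> \<le> kernel_mass k (b - a)"
    unfolding kernel_mass_def using assms(2)
    by (intro nn_integral_mono) (auto simp: indicator_def)
  finally show ?thesis .
qed

lemma nn_integral_translated_kernel_le:
  fixes k :: "real \<Rightarrow> real"
  assumes [measurable]: "k \<in> borel_measurable borel" and "a \<le> s"
  shows "(\<integral>\<^sup>+ t. ennreal \<bar>k (t - s)\<bar> * indicator {a..t} s \<partial>lebesgue_on {a..b}) \<le> kernel_mass k (b - a)"
proof -
  let ?g = "\<lambda>u. ennreal \<bar>k u\<bar> * indicator {0..b - a} u"
  have "(\<integral>\<^sup>+ t. ennreal \<bar>k (t - s)\<bar> * indicator {a..t} s \<partial>lebesgue_on {a..b})
      = (\<integral>\<^sup>+ t. ennreal \<bar>k (t - s)\<bar> * indicator {s..} t \<partial>lebesgue_on {a..b})"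
    using assms(2) by (intro nn_integral_cong) (auto simp: indicator_def)
  also have "\<dots> = (\<integral>\<^sup>+ t. ennreal \<bar>k (t - s)\<bar> * indicator {s..} t * indicator {a..b} t \<partial>lborel)"
    by (rule nn_integral_lebesgue_on_Icc_borel) measurable
  also have "\<dots> \<le> (\<integral>\<^sup>+ t. ?g (- s + 1 * t) \<partial>lborel)"
    using assms(2) by (intro nn_integral_mono) (auto simp: indicator_def)
  also have "\<dots> = (\<integral>\<^sup>+ u. ?g u \<partial>lborel)"
    by (subst nn_integral_real_affine[of ?g 1 "- s"]) auto
  finally show ?thesis
    unfolding kernel_mass_def .
qed

text \<open>A product of two completed measures is not complete, but \<open>k\<close> is Borel, so it suffices that the two
  projections are measurable into the Borel sets.  The indicator of the triangle
  \<open>s \<le> t\<close> turns integrals over \<open>[a, t]\<close> into integrals over the fixed interval \<open>[a, b]\<close>.\<close>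

lemma measurable_causal_kernel:
  fixes k :: "real \<Rightarrow> real"
  assumes [measurable]: "k \<in> borel_measurable borel"
  shows "(\<lambda>(t, s). k (t - s)) \<in> borel_measurable (lebesgue_on {a..b::real} \<Otimes>\<^sub>M lebesgue_on {a..b})"
    and "(\<lambda>(t, s). indicator {a..t} s :: real) \<in> borel_measurable (lebesgue_on {a..b::real} \<Otimes>\<^sub>M lebesgue_on {a..b})"
    and "(\<lambda>(t, s). indicator {a..t} s :: ennreal) \<in> borel_measurable (lebesgue_on {a..b::real} \<Otimes>\<^sub>M lebesgue_on {a..b})"
proof -
  let ?M = "lebesgue_on {a..b}"
  have id: "(\<lambda>x. x) \<in> borel_measurable ?M"
    by (rule borel_measurable_lebesgue_on_Icc) measurable
  have [measurable]: "fst \<in> borel_measurable (?M \<Otimes>\<^sub>M ?M)" "snd \<in> borel_measurable (?M \<Otimes>\<^sub>M ?M)"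
    using measurable_compose[OF measurable_fst id] measurable_compose[OF measurable_snd id] by auto
  show "(\<lambda>(t, s). k (t - s)) \<in> borel_measurable (?M \<Otimes>\<^sub>M ?M)"
    unfolding case_prod_beta by measurable
  have "(\<lambda>p. if a \<le> snd p \<and> snd p \<le> fst p then 1 else 0 :: real) \<in> borel_measurable (?M \<Otimes>\<^sub>M ?M)"
    by measurable
  then show "(\<lambda>(t, s). indicator {a..t} s :: real) \<in> borel_measurable (?M \<Otimes>\<^sub>M ?M)"
    by (simp add: case_prod_beta indicator_def of_bool_def)
  have "(\<lambda>p. if a \<le> snd p \<and> snd p \<le> fst p then 1 else 0 :: ennreal) \<in> borel_measurable (?M \<Otimes>\<^sub>M ?M)"
    by measurable
  then show "(\<lambda>(t, s). indicator {a..t} s :: ennreal) \<in> borel_measurable (?M \<Otimes>\<^sub>M ?M)"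
    by (simp add: case_prod_beta indicator_def of_bool_def)
qed

text \<open>Tonelli's theorem on the triangle \<open>a \<le> s \<le> t \<le> b\<close>: for fixed \<open>s\<close> the kernel is integrated over
  \<open>t - s\<close>, which stays in \<open>[0, b - a]\<close>.\<close>

lemma
  fixes F :: "real \<Rightarrow> ennreal"
    and k :: "real \<Rightarrow> real"
  assumes k [measurable]: "k \<in> borel_measurable borel"
    and F [measurable]: "F \<in> borel_measurable (lebesgue_on {a..b})"
  shows borel_measurable_causal_convolution:
      "(\<lambda>t. \<integral>\<^sup>+ s. ennreal \<bar>k (t - s)\<bar> * F s \<partial>lebesgue_on {a..t}) \<in> borel_measurable (lebesgue_on {a..b})" (is ?meas)
    and nn_integral_causal_convolution_le:
      "(\<integral>\<^sup>+ t. \<integral>\<^sup>+ s. ennreal \<bar>k (t - s)\<bar> * F s \<partial>lebesgue_on {a..t} \<partial>lebesgue_on {a..b})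
        \<le> kernel_mass k (b - a) * (\<integral>\<^sup>+ s. F s \<partial>lebesgue_on {a..b})" (is ?le)
proof -
  let ?M = "lebesgue_on {a..b}"
  interpret sigma_finite_measure ?M by (rule sigma_finite_lebesgue_on_Icc)
  interpret P: pair_sigma_finite ?M ?M ..
  define G where "G t s = ennreal \<bar>k (t - s)\<bar> * F s * indicator {a..t} s" for t s
  note [measurable] = measurable_causal_kernel(1)[OF k, of a b] measurable_causal_kernel(3)[OF k, of a b]
  have G [measurable]: "case_prod G \<in> borel_measurable (?M \<Otimes>\<^sub>M ?M)"
    unfolding G_def by measurable
  have eq: "(\<integral>\<^sup>+ s. ennreal \<bar>k (t - s)\<bar> * F s \<partial>lebesgue_on {a..t}) = (\<integral>\<^sup>+ s. G t s \<partial>?M)" if "t \<in> {a..b}" for t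
    using that unfolding G_def by (intro nn_integral_lebesgue_on_subinterval) auto
  have "(\<lambda>t. \<integral>\<^sup>+ s. G t s \<partial>?M) \<in> borel_measurable ?M"
    by measurable
  also have "?this \<longleftrightarrow> ?meas"
    by (rule measurable_cong) (simp add: eq)
  finally show ?meas .
  have "(\<integral>\<^sup>+ t. \<integral>\<^sup>+ s. ennreal \<bar>k (t - s)\<bar> * F s \<partial>lebesgue_on {a..t} \<partial>?M) = (\<integral>\<^sup>+ t. \<integral>\<^sup>+ s. G t s \<partial>?M \<partial>?M)"
    by (rule nn_integral_cong) (simp add: eq)
  also have "\<dots> = (\<integral>\<^sup>+ s. \<integral>\<^sup>+ t. G t s \<partial>?M \<partial>?M)"
    by (rule P.Fubini'[symmetric]) measurable
  also have "\<dots> \<le> (\<integral>\<^sup>+ s. kernel_mass k (b - a) * F s \<partial>?M)"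
  proof (rule nn_integral_mono)
    fix s assume s: "s \<in> space ?M"
    have "(\<lambda>t. ennreal \<bar>k (t - s)\<bar> * indicator {a..t} s) \<in> borel_measurable ?M"
    proof -
      have "(\<lambda>t. ennreal \<bar>k (t - s)\<bar> * (if a \<le> s \<and> s \<le> t then 1 else 0)) \<in> borel_measurable ?M"
        by (rule borel_measurable_lebesgue_on_Icc) measurable
      then show ?thesis by (simp add: indicator_def of_bool_def)
    qed
    then have "(\<integral>\<^sup>+ t. ennreal \<bar>k (t - s)\<bar> * indicator {a..t} s * F s \<partial>?M)
        = (\<integral>\<^sup>+ t. ennreal \<bar>k (t - s)\<bar> * indicator {a..t} s \<partial>?M) * F s"
      by (rule nn_integral_multc)
    also have "\<dots> \<le> kernel_mass k (b - a) * F s"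
      using s by (intro mult_right_mono nn_integral_translated_kernel_le k) auto
    finally show "(\<integral>\<^sup>+ t. G t s \<partial>?M) \<le> kernel_mass k (b - a) * F s"
      by (simp add: G_def mult_ac)
  qed
  also have "\<dots> = kernel_mass k (b - a) * (\<integral>\<^sup>+ s. F s \<partial>?M)"
    by (rule nn_integral_cmult) measurable
  finally show ?le .
qed

lemma AE_causal_convolution_finite:
  fixes F :: "real \<Rightarrow> ennreal"
    and k :: "real \<Rightarrow> real"
  assumes "k \<in> borel_measurable borel" "F \<in> borel_measurable (lebesgue_on {a..b})"
    and "kernel_mass k (b - a) < \<infinity>" "(\<integral>\<^sup>+ s. F s \<partial>lebesgue_on {a..b}) < \<infinity>"
  shows "AE t in lebesgue_on {a..b}. (\<integral>\<^sup>+ s. ennreal \<bar>k (t - s)\<bar> * F s \<partial>lebesgue_on {a..t}) < \<infinity>"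
proof -
  have "kernel_mass k (b - a) * (\<integral>\<^sup>+ s. F s \<partial>lebesgue_on {a..b}) < \<infinity>"
    using assms(3,4) by (simp add: ennreal_mult_less_top)
  then have "(\<integral>\<^sup>+ t. \<integral>\<^sup>+ s. ennreal \<bar>k (t - s)\<bar> * F s \<partial>lebesgue_on {a..t} \<partial>lebesgue_on {a..b}) \<noteq> \<infinity>"
    using nn_integral_causal_convolution_le[OF assms(1,2)] by (metis infinity_ennreal_def leD)
  from nn_integral_PInf_AE[OF borel_measurable_causal_convolution[OF assms(1,2)] this]
  show ?thesis by eventually_elim (simp add: less_top)
qed

lemma has_banach_integral_volterra:
  fixes k :: "real \<Rightarrow> real"
  assumes "k \<in> borel_measurable borel" "strongly_measurable (lebesgue_on {a..b}) f" "t \<le> b"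
    and "(\<integral>\<^sup>+ s. ennreal \<bar>k (t - s)\<bar> * norm (f s) \<partial>lebesgue_on {a..t}) < \<infinity>"
  shows "has_banach_integral (lebesgue_on {a..t}) (\<lambda>s. k (t - s) *\<^sub>R f s) (volterra k a f t)"
proof -
  interpret complete_measure "lebesgue_on {a..t}" by (rule complete_lebesgue_on_Icc)
  show ?thesis
    unfolding volterra_def
    by (intro has_banach_integral_banach_integral finite_lebesgue_on_Icc
        strongly_measurable_volterra_integrand[OF assms(1-3)])
      (use assms(4) in \<open>simp add: ennreal_mult\<close>)
qed

lemma borel_measurable_volterra_indicator:
  fixes k :: "real \<Rightarrow> real"
  assumes k [measurable]: "k \<in> borel_measurable borel" and A [measurable]: "A \<in> sets (lebesgue_on {a..b})"
  shows "(\<lambda>t. \<integral>s. k (t - s) * indicator A s \<partial>lebesgue_on {a..t}) \<in> borel_measurable (lebesgue_on {a..b})"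
proof -
  let ?M = "lebesgue_on {a..b}"
  interpret sigma_finite_measure ?M by (rule sigma_finite_lebesgue_on_Icc)
  note [measurable] = measurable_causal_kernel(1,2)[OF k, of a b]
  have "(\<lambda>t. \<integral>s. indicator {a..t} s *\<^sub>R (k (t - s) * indicator A s) \<partial>?M) \<in> borel_measurable ?M"
    by measurable
  also have "?this \<longleftrightarrow> ?thesis"
  proof (rule measurable_cong)
    fix t assume "t \<in> space ?M"
    then have t: "t \<le> b" by simp
    show "(\<integral>s. indicator {a..t} s *\<^sub>R (k (t - s) * indicator A s) \<partial>?M) = (\<integral>s. k (t - s) * indicator A s \<partial>lebesgue_on {a..t})"
      unfolding lebesgue_on_Icc_subinterval[OF t]
      by (rule integral_restrict_space[symmetric]) (use t in \<open>auto simp: sets_restrict_space\<close>)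
  qed
  finally show ?thesis .
qed

text \<open>For a simple function the vector-valued integral is a finite combination of Lebesgue integrals of
  real functions.  These exist for every \<open>t\<close>: the function is bounded and the kernel integrable.\<close>

lemma volterra_simple_function:
  fixes u :: "real \<Rightarrow> 'b::banach"
  assumes k: "k \<in> borel_measurable borel" "kernel_mass k (b - a) < \<infinity>"
    and u: "simple_function (lebesgue_on {a..b}) u" and t: "t \<in> {a..b}"
  shows "volterra k a u t =
    (\<Sum>v\<in>u ` {a..b}. (\<integral>s. k (t - s) * indicator (u -` {v} \<inter> {a..b}) s \<partial>lebesgue_on {a..t}) *\<^sub>R v)"
proof -
  interpret complete_measure "lebesgue_on {a..t}" by (rule complete_lebesgue_on_Icc)
  have fin: "finite (u ` {a..b})"
    using simple_functionD(1)[OF u] by simp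
  have "has_banach_integral (lebesgue_on {a..t})
      (\<lambda>s. \<Sum>v\<in>u ` {a..b}. (k (t - s) * indicator (u -` {v} \<inter> {a..b}) s) *\<^sub>R v)
      (\<Sum>v\<in>u ` {a..b}. (\<integral>s. k (t - s) * indicator (u -` {v} \<inter> {a..b}) s \<partial>lebesgue_on {a..t}) *\<^sub>R v)"
  proof (rule has_banach_integral_sum[OF fin])
    fix v assume "v \<in> u ` {a..b}"
    have A: "u -` {v} \<inter> {a..b} \<in> sets (lebesgue_on {a..b})"
      using simple_functionD(2)[OF u, of "{v}"] by simp
    have "(\<lambda>s. indicator (u -` {v} \<inter> {a..b}) s :: real) \<in> borel_measurable (lebesgue_on {a..t})"
      by (rule borel_measurable_lebesgue_on_subinterval[OF borel_measurable_indicator[OF A]]) (use t in simp)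
    note [measurable] = this measurable_reflected_kernel[OF k(1), of t a t]
    have "integrable (lebesgue_on {a..t}) (\<lambda>s. k (t - s) * indicator (u -` {v} \<inter> {a..b}) s)"
    proof (rule integrableI_bounded)
      have "(\<integral>\<^sup>+ s. norm (k (t - s) * indicator (u -` {v} \<inter> {a..b}) s) \<partial>lebesgue_on {a..t})
          \<le> (\<integral>\<^sup>+ s. ennreal \<bar>k (t - s)\<bar> \<partial>lebesgue_on {a..t})"
        by (intro nn_integral_mono) (auto simp: indicator_def)
      also have "\<dots> \<le> kernel_mass k (b - a)"
        using t by (intro nn_integral_reflected_kernel_le k) simp
      finally show "(\<integral>\<^sup>+ s. norm (k (t - s) * indicator (u -` {v} \<inter> {a..b}) s) \<partial>lebesgue_on {a..t}) < \<infinity>"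
        using k(2) by (rule le_less_trans)
    qed measurable
    then show "has_banach_integral (lebesgue_on {a..t})
        (\<lambda>s. (k (t - s) * indicator (u -` {v} \<inter> {a..b}) s) *\<^sub>R v)
        ((\<integral>s. k (t - s) * indicator (u -` {v} \<inter> {a..b}) s \<partial>lebesgue_on {a..t}) *\<^sub>R v)"
      by (intro has_banach_integral_bounded_linear[OF bounded_linear_scaleR_left]
          has_bochner_integral_imp_banach has_bochner_integral_integrable)
  qed
  then have "has_banach_integral (lebesgue_on {a..t}) (\<lambda>s. k (t - s) *\<^sub>R u s)
      (\<Sum>v\<in>u ` {a..b}. (\<integral>s. k (t - s) * indicator (u -` {v} \<inter> {a..b}) s \<partial>lebesgue_on {a..t}) *\<^sub>R v)"
  proof (rule has_banach_integral_cong)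
    fix s assume "s \<in> space (lebesgue_on {a..t})"
    with t have s: "s \<in> {a..b}" by simp
    have "(\<Sum>v\<in>u ` {a..b}. (k (t - s) * indicator (u -` {v} \<inter> {a..b}) s) *\<^sub>R v)
        = (\<Sum>v\<in>{u s}. (k (t - s) * indicator (u -` {v} \<inter> {a..b}) s) *\<^sub>R v)"
      using s by (intro sum.mono_neutral_right fin) auto
    with s show "(\<Sum>v\<in>u ` {a..b}. (k (t - s) * indicator (u -` {v} \<inter> {a..b}) s) *\<^sub>R v) = k (t - s) *\<^sub>R u s"
      by simp
  qed
  then show ?thesis
    unfolding volterra_def by (rule banach_integral_eqI)
qed

lemma strongly_measurable_volterra_simple_function:
  fixes u :: "real \<Rightarrow> 'b::banach"
  assumes k: "k \<in> borel_measurable borel" "kernel_mass k (b - a) < \<infinity>"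
    and u: "simple_function (lebesgue_on {a..b}) u"
  shows "strongly_measurable (lebesgue_on {a..b}) (volterra k a u)"
proof (rule strongly_measurable_cong_AE)
  have A: "u -` {v} \<inter> {a..b} \<in> sets (lebesgue_on {a..b})" for v
    using simple_functionD(2)[OF u, of "{v}"] by simp
  show "strongly_measurable (lebesgue_on {a..b})
      (\<lambda>t. \<Sum>v\<in>u ` {a..b}. (\<integral>s. k (t - s) * indicator (u -` {v} \<inter> {a..b}) s \<partial>lebesgue_on {a..t}) *\<^sub>R v)"
    using simple_functionD(1)[OF u]
    by (intro strongly_measurable_sum strongly_measurable_scaleR strongly_measurable_const
        borel_measurable_imp_strongly_measurable borel_measurable_volterra_indicator k A) simp
  show "AE t in lebesgue_on {a..b}.
      (\<Sum>v\<in>u ` {a..b}. (\<integral>s. k (t - s) * indicator (u -` {v} \<inter> {a..b}) s \<partial>lebesgue_on {a..t}) *\<^sub>R v)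
        = volterra k a u t"
    by (rule AE_I2) (simp add: volterra_simple_function[OF k u])
qed

text \<open>At every \<open>t\<close> where \<open>\<integral> |k(t - s)| |f(s)| ds\<close> is finite, hence at almost every \<open>t\<close>, dominated
  convergence carries the approximation of \<open>f\<close> by simple functions over to the convolution.\<close>

proposition strongly_measurable_volterra:
  fixes f :: "real \<Rightarrow> 'b::banach"
  assumes k: "k \<in> borel_measurable borel" "kernel_mass k (b - a) < \<infinity>"
    and f: "strongly_measurable (lebesgue_on {a..b}) f" "(\<integral>\<^sup>+ s. norm (f s) \<partial>lebesgue_on {a..b}) < \<infinity>"
  shows "strongly_measurable (lebesgue_on {a..b}) (volterra k a f)"
proof -
  interpret M: complete_measure "lebesgue_on {a..b}" by (rule complete_lebesgue_on_Icc)
  obtain u where u: "\<And>i. simple_function (lebesgue_on {a..b}) (u i)" "\<And>i x. norm (f x - u i x) \<le> norm (f x)"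
    "AE x in lebesgue_on {a..b}. (\<lambda>i::nat. u i x) \<longlonglongrightarrow> f x"
    by (rule M.strongly_measurable_approximation[OF f(1)]) blast
  show ?thesis
  proof (rule M.strongly_measurable_LIMSEQ_AE)
    show "strongly_measurable (lebesgue_on {a..b}) (volterra k a (u i))" for i
      by (rule strongly_measurable_volterra_simple_function[OF k u(1)])
    have "(\<lambda>s. ennreal (norm (f s))) \<in> borel_measurable (lebesgue_on {a..b})"
      using M.borel_measurable_norm_strongly_measurable[OF f(1)] by simp
    from AE_causal_convolution_finite[OF k(1) this k(2) f(2)]
    have "AE t in lebesgue_on {a..b}. t \<in> {a..b} \<and>
        (\<integral>\<^sup>+ s. ennreal \<bar>k (t - s)\<bar> * norm (f s) \<partial>lebesgue_on {a..t}) < \<infinity>"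
      using AE_space by eventually_elim simp
    then show "AE t in lebesgue_on {a..b}. (\<lambda>i. volterra k a (u i) t) \<longlonglongrightarrow> volterra k a f t"
    proof eventually_elim
      case (elim t)
      let ?N = "lebesgue_on {a..t}"
      interpret N: complete_measure ?N by (rule complete_lebesgue_on_Icc)
      from elim have t: "t \<le> b" "t \<in> {a..b}"
        and fin: "(\<integral>\<^sup>+ s. ennreal \<bar>k (t - s)\<bar> * norm (f s) \<partial>?N) < \<infinity>" by auto
      have sm: "strongly_measurable ?N f" "strongly_measurable ?N (u i)" for i
        using f(1) simple_function_imp_strongly_measurable[OF u(1)] t(1)
        by (auto intro: strongly_measurable_lebesgue_on_subinterval)
      have [measurable]: "(\<lambda>s. norm (f s)) \<in> borel_measurable ?N"
        "(\<lambda>s. norm (f s - u i s)) \<in> borel_measurable ?N" "(\<lambda>s. k (t - s)) \<in> borel_measurable ?N" for i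
        using sm by (auto intro!: N.borel_measurable_norm_strongly_measurable strongly_measurable_diff
            measurable_reflected_kernel k)
      have int_f: "has_banach_integral ?N (\<lambda>s. k (t - s) *\<^sub>R f s) (volterra k a f t)"
        by (rule has_banach_integral_volterra[OF k(1) f(1) t(1) fin])
      have int_u: "has_banach_integral ?N (\<lambda>s. k (t - s) *\<^sub>R u i s) (volterra k a (u i) t)" for i
      proof (rule has_banach_integral_volterra[OF k(1) simple_function_imp_strongly_measurable[OF u(1)] t(1)])
        have "(\<integral>\<^sup>+ s. ennreal \<bar>k (t - s)\<bar> * norm (u i s) \<partial>?N)
            \<le> (\<integral>\<^sup>+ s. 2 * (ennreal \<bar>k (t - s)\<bar> * norm (f s)) \<partial>?N)"
        proof (rule nn_integral_mono)
          fix s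
          have "norm (u i s) \<le> 2 * norm (f s)"
            using u(2)[of s i] norm_triangle_sub[of "u i s" "f s"] by (simp add: norm_minus_commute)
          then have "\<bar>k (t - s)\<bar> * norm (u i s) \<le> 2 * (\<bar>k (t - s)\<bar> * norm (f s))"
            using mult_left_mono[of "norm (u i s)" "2 * norm (f s)" "\<bar>k (t - s)\<bar>"] by (simp add: mult_ac)
          then have "ennreal (\<bar>k (t - s)\<bar> * norm (u i s)) \<le> ennreal (2 * (\<bar>k (t - s)\<bar> * norm (f s)))"
            by (rule ennreal_leI)
          then show "ennreal \<bar>k (t - s)\<bar> * norm (u i s) \<le> 2 * (ennreal \<bar>k (t - s)\<bar> * norm (f s))"
            by (simp add: ennreal_mult)
        qed
        also have "\<dots> = 2 * (\<integral>\<^sup>+ s. ennreal \<bar>k (t - s)\<bar> * norm (f s) \<partial>?N)"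
          by (rule nn_integral_cmult) measurable
        also have "\<dots> < \<infinity>"
          using fin by (simp add: ennreal_mult_less_top)
        finally show "(\<integral>\<^sup>+ s. ennreal \<bar>k (t - s)\<bar> * norm (u i s) \<partial>?N) < \<infinity>" .
      qed
      have "(\<lambda>i. \<integral>\<^sup>+ s. ennreal (\<bar>k (t - s)\<bar> * norm (f s - u i s)) \<partial>?N) \<longlonglongrightarrow> (\<integral>\<^sup>+ s. 0 \<partial>?N)"
      proof (rule nn_integral_dominated_convergence[where w = "\<lambda>s. ennreal \<bar>k (t - s)\<bar> * norm (f s)"])
        show "AE s in ?N. ennreal (\<bar>k (t - s)\<bar> * norm (f s - u i s)) \<le> ennreal \<bar>k (t - s)\<bar> * norm (f s)" for i
          using u(2) by (intro AE_I2) (auto simp: ennreal_mult[symmetric] intro!: ennreal_leI mult_left_mono)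
        show "AE s in ?N. (\<lambda>i. ennreal (\<bar>k (t - s)\<bar> * norm (f s - u i s))) \<longlonglongrightarrow> 0"
          using AE_lebesgue_on_subinterval[OF u(3) t(1)]
        proof eventually_elim
          case (elim s)
          have "(\<lambda>i. ennreal (\<bar>k (t - s)\<bar> * norm (f s - u i s))) \<longlonglongrightarrow> ennreal (\<bar>k (t - s)\<bar> * norm (f s - f s))"
            by (intro tendsto_ennrealI tendsto_intros elim)
          then show ?case by simp
        qed
      qed (use fin in auto)
      then have "(\<lambda>i. \<integral>\<^sup>+ s. ennreal (\<bar>k (t - s)\<bar> * norm (f s - u i s)) \<partial>?N) \<longlonglongrightarrow> 0"
        by simp
      moreover have "ennreal (norm (volterra k a (u i) t - volterra k a f t))
          \<le> (\<integral>\<^sup>+ s. ennreal (\<bar>k (t - s)\<bar> * norm (f s - u i s)) \<partial>?N)" for i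
        using N.has_banach_integral_norm_le[OF N.has_banach_integral_diff[OF int_f int_u[of i]]]
        by (simp add: norm_minus_commute flip: scaleR_diff_right)
      ultimately have "(\<lambda>i. ennreal (norm (volterra k a (u i) t - volterra k a f t))) \<longlonglongrightarrow> 0"
        by (rule ennreal_LIMSEQ_0_mono[rotated])
      then have "(\<lambda>i. norm (volterra k a (u i) t - volterra k a f t)) \<longlonglongrightarrow> 0"
        by (simp flip: ennreal_0)
      then show ?case
        by (simp add: LIM_zero_iff tendsto_norm_zero_iff)
    qed
  qed
qed


section \<open>Young's inequality for causal convolution\<close>

text \<open>Hoelder's inequality in the form \<open>(\<integral> w g)\<^sup>q \<le> (\<integral> w)\<^sup>q\<^sup>-\<^sup>1 \<integral> w g\<^sup>q\<close>.  The convex function \<open>u\<^sup>q\<close> lies above its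
  tangent at any \<open>l > 0\<close>, that is \<open>u \<le> l\<^sup>1\<^sup>-\<^sup>q u\<^sup>q / q + (1 - 1/q) l\<close>.  Integrate this against \<open>w\<close> at
  the point \<open>l = r / A\<close>, which makes the last term equal to \<open>(1 - 1/q) r\<close>, and absorb it on the left.
  The number \<open>r\<close> stands for the left integral, so that nothing is divided by a quantity that may be
  infinite.\<close>

lemma weighted_power_mean_le:
  fixes w g :: "'a \<Rightarrow> real" and r A q :: real
  assumes [measurable]: "w \<in> borel_measurable M" "g \<in> borel_measurable M"
    and nonneg: "\<And>x. 0 \<le> w x" "\<And>x. 0 \<le> g x"
    and A: "0 < A" "(\<integral>\<^sup>+ x. w x \<partial>M) \<le> ennreal A"
    and r: "0 \<le> r" "ennreal r \<le> (\<integral>\<^sup>+ x. ennreal (w x) * g x \<partial>M)" and q: "1 \<le> q"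
  shows "ennreal (r powr q) \<le> ennreal (A powr (q - 1)) * (\<integral>\<^sup>+ x. ennreal (w x) * (g x powr q) \<partial>M)"
proof (cases "r = 0")
  case False
  let ?B = "\<integral>\<^sup>+ x. ennreal (w x) * (g x powr q) \<partial>M"
  define l where "l = r / A"
  define c where "c = l powr (1 - q) / q"
  have l: "0 < l" using False r(1) A(1) by (simp add: l_def)
  have c: "0 < c" using l q by (simp add: c_def)
  have young: "u \<le> c * u powr q + (1 - 1 / q) * l" if "0 \<le> u" for u
  proof (cases "u = 0")
    case False
    with that l have ul: "0 < u / l" by simp
    (* AM-GM with weights 1/q and 1 - 1/q for (u/l)^q and 1 is the tangent inequality at l *)
    have "((u / l) powr q) powr (1 / q) * 1 powr (1 - 1 / q) \<le> 1 / q * (u / l) powr q + (1 - 1 / q) * 1"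
      using ul q by (intro Youngs_inequality_0) auto
    then have "u / l \<le> 1 / q * (u / l) powr q + (1 - 1 / q)"
      using ul q l that by (simp add: powr_powr)
    then have "u / l * l \<le> (1 / q * (u / l) powr q + (1 - 1 / q)) * l"
      using l by (intro mult_right_mono) auto
    also have "1 / q * (u / l) powr q * l = c * u powr q"
      using l that by (simp add: c_def powr_divide powr_diff mult_ac)
    then have "(1 / q * (u / l) powr q + (1 - 1 / q)) * l = c * u powr q + (1 - 1 / q) * l"
      by (simp only: distrib_right)
    finally show ?thesis using l by simp
  qed (use l q in simp)
  show ?thesis
  proof (cases "?B = \<infinity>")
    case True
    then show ?thesis using A(1) by (simp add: ennreal_mult_top)
  next
    case False
    then obtain \<beta> where \<beta>: "0 \<le> \<beta>" "?B = ennreal \<beta>"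
      by (cases ?B) auto
    have "ennreal r \<le> (\<integral>\<^sup>+ x. ennreal c * (ennreal (w x) * (g x powr q)) + ennreal ((1 - 1 / q) * l) * ennreal (w x) \<partial>M)"
    proof (rule order_trans[OF r(2) nn_integral_mono])
      fix x
      have "w x * g x \<le> w x * (c * g x powr q + (1 - 1 / q) * l)"
        using nonneg by (intro mult_left_mono young) auto
      also have "\<dots> = c * (w x * g x powr q) + (1 - 1 / q) * l * w x"
        by (simp add: algebra_simps)
      finally have "ennreal (w x * g x) \<le> ennreal (c * (w x * g x powr q) + (1 - 1 / q) * l * w x)"
        by (rule ennreal_leI)
      then show "ennreal (w x) * ennreal (g x) \<le> ennreal c * (ennreal (w x) * ennreal (g x powr q)) + ennreal ((1 - 1 / q) * l) * ennreal (w x)"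
        using nonneg c l q by (simp add: ennreal_mult[symmetric] ennreal_plus[symmetric] del: ennreal_plus)
    qed
    also have "\<dots> = ennreal c * ?B + ennreal ((1 - 1 / q) * l) * (\<integral>\<^sup>+ x. w x \<partial>M)"
      by (simp add: nn_integral_add nn_integral_cmult)
    also have "\<dots> \<le> ennreal c * ennreal \<beta> + ennreal ((1 - 1 / q) * l) * ennreal A"
      unfolding \<beta>(2) by (intro add_left_mono mult_left_mono A) simp
    also have "\<dots> = ennreal (c * \<beta> + (1 - 1 / q) * l * A)"
      using c \<beta>(1) l q A(1) by (simp add: ennreal_mult[symmetric] ennreal_plus[symmetric] del: ennreal_plus)
    finally have "r \<le> c * \<beta> + (1 - 1 / q) * l * A"
      using c \<beta>(1) l q A(1) by (subst (asm) ennreal_le_iff) auto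
    then have "r / q \<le> c * \<beta>"
      using A(1) by (simp add: l_def algebra_simps)
    then have "r \<le> l powr (1 - q) * \<beta>"
      using q by (simp add: c_def field_simps)
    then have "r * l powr (q - 1) \<le> l powr (1 - q) * \<beta> * l powr (q - 1)"
      by (rule mult_right_mono) simp
    also have "\<dots> = \<beta>"
      using l by (simp add: powr_add[symmetric] mult.commute mult.left_commute)
    also have "r * l powr (q - 1) = r powr q / A powr (q - 1)"
      using r(1) False A(1) \<open>r \<noteq> 0\<close> by (simp add: l_def powr_divide powr_diff)
    finally have "r powr q \<le> A powr (q - 1) * \<beta>"
      using A(1) by (simp add: field_simps)
    then show ?thesis
      using \<beta> by (simp add: ennreal_mult[symmetric] ennreal_leI)
  qed
qed (use q in simp)

lemma enn2real_exponent_ge_1: "1 \<le> p \<Longrightarrow> p \<noteq> \<infinity> \<Longrightarrow> 1 \<le> enn2real p"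
  using enn2real_mono[of 1 p] by (simp add: less_top)

text \<open>Comparing \<open>q\<close>-th powers avoids roots of possibly infinite integrals.\<close>

lemma Lp_norm_le_iff:
  assumes "p \<noteq> \<infinity>" "1 \<le> p" "0 \<le> A"
  shows "Lp_norm p M f \<le> ennreal A \<longleftrightarrow>
    (\<integral>\<^sup>+ x. ennreal (norm (f x) powr enn2real p) \<partial>M) \<le> ennreal (A powr enn2real p)"
proof -
  let ?I = "\<integral>\<^sup>+ x. ennreal (norm (f x) powr enn2real p) \<partial>M" and ?q = "enn2real p"
  have q: "1 \<le> ?q" using assms by (intro enn2real_exponent_ge_1)
  show ?thesis
  proof (cases ?I)
    case (real i)
    have "i powr (1 / ?q) \<le> A \<longleftrightarrow> i \<le> A powr ?q"
    proof
      assume "i powr (1 / ?q) \<le> A"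
      then have "(i powr (1 / ?q)) powr ?q \<le> A powr ?q"
        using q by (intro powr_mono2) auto
      then show "i \<le> A powr ?q" using q real(1) by (simp add: powr_powr)
    next
      assume "i \<le> A powr ?q"
      then have "i powr (1 / ?q) \<le> (A powr ?q) powr (1 / ?q)"
        using q real(1) by (intro powr_mono2) auto
      then show "i powr (1 / ?q) \<le> A" using q assms(3) by (simp add: powr_powr)
    qed
    with real assms show ?thesis
      by (simp add: Lp_norm_def)
  next
    case top
    with assms show ?thesis by (simp add: Lp_norm_def top_unique)
  qed
qed

lemma (in complete_measure) Lp_norm_infinity_le:
  fixes f :: "'a \<Rightarrow> 'b::real_normed_vector"
  assumes "strongly_measurable M f" "AE x in M. norm (f x) \<le> A"
  shows "Lp_norm \<infinity> M f \<le> ennreal A"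
  unfolding Lp_norm_def using borel_measurable_norm_strongly_measurable[OF assms(1)] assms(2)
  by (auto intro!: esssup_I ennreal_leI elim: eventually_mono)

lemma AE_norm_le_1_if_Lp_norm_infinity:
  assumes "Lp_norm \<infinity> M f \<le> 1"
  shows "AE x in M. norm (f x) \<le> 1"
proof -
  have "AE x in M. ennreal (norm (f x)) \<le> Lp_norm \<infinity> M f"
    unfolding Lp_norm_def using esssup_AE[of "\<lambda>x. ennreal (norm (f x))" M] by simp
  then show ?thesis
  proof eventually_elim
    case (elim x)
    from order_trans[OF elim assms] show ?case by simp
  qed
qed

text \<open>On a finite measure \<open>L\<^sup>p\<close> embeds in \<open>L\<^sup>1\<close>: for finite \<open>p\<close>, use \<open>u \<le> 1 + u\<^sup>p\<close>.\<close>

lemma (in complete_measure) nn_integral_norm_finite_if_Lp_norm_le_1: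
  fixes f :: "'a \<Rightarrow> 'b::real_normed_vector"
  assumes "finite_measure M" "strongly_measurable M f" "1 \<le> p" "Lp_norm p M f \<le> 1"
  shows "(\<integral>\<^sup>+ x. norm (f x) \<partial>M) < \<infinity>"
proof -
  have fin: "emeasure M (space M) < \<infinity>"
    using finite_measure.emeasure_finite[OF assms(1)] by (simp add: less_top)
  have [measurable]: "(\<lambda>x. norm (f x)) \<in> borel_measurable M"
    by (rule borel_measurable_norm_strongly_measurable) fact
  show ?thesis
  proof (cases "p = \<infinity>")
    case True
    then have "AE x in M. norm (f x) \<le> 1"
      using assms(4) AE_norm_le_1_if_Lp_norm_infinity by blast
    then have "(\<integral>\<^sup>+ x. norm (f x) \<partial>M) \<le> (\<integral>\<^sup>+ x. 1 \<partial>M)"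
      by (intro nn_integral_mono_AE) (auto elim!: eventually_mono)
    also have "\<dots> < \<infinity>" using fin by simp
    finally show ?thesis .
  next
    case False
    let ?q = "enn2real p"
    have q: "1 \<le> ?q" using assms False by (intro enn2real_exponent_ge_1)
    have "(\<integral>\<^sup>+ x. norm (f x) \<partial>M) \<le> (\<integral>\<^sup>+ x. 1 + ennreal (norm (f x) powr ?q) \<partial>M)"
    proof (rule nn_integral_mono)
      fix x
      have "norm (f x) \<le> 1 + norm (f x) powr ?q"
      proof (cases "norm (f x) \<le> 1")
        case False
        then have "norm (f x) powr 1 \<le> norm (f x) powr ?q"
          using q by (intro powr_mono) auto
        then show ?thesis by simp
      qed (simp add: add_increasing2)
      then show "ennreal (norm (f x)) \<le> 1 + ennreal (norm (f x) powr ?q)"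
        by (simp flip: ennreal_1 ennreal_plus)
    qed
    also have "\<dots> = emeasure M (space M) + (\<integral>\<^sup>+ x. ennreal (norm (f x) powr ?q) \<partial>M)"
      by (subst nn_integral_add) auto
    also have "\<dots> < \<infinity>"
    proof -
      have "(\<integral>\<^sup>+ x. ennreal (norm (f x) powr ?q) \<partial>M) \<le> 1"
        using Lp_norm_le_iff[OF False assms(3), of 1 M f] assms(4) by simp
      then have "(\<integral>\<^sup>+ x. ennreal (norm (f x) powr ?q) \<partial>M) < \<infinity>"
        by (rule le_less_trans) simp
      then show ?thesis using fin by simp
    qed
    finally show ?thesis .
  qed
qed

text \<open>For finite \<open>p\<close>, raise the pointwise bound to the power \<open>p\<close> with \<open>weighted_power_mean_le\<close>, where the
  weight \<open>|k(t - s)|\<close> has total mass at most \<open>A\<close>; Tonelli's theorem supplies the remaining factor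
  \<open>A\<close>.  The function \<open>g\<close> is only assumed to be bounded almost everywhere by the convolution of the norms:
  a difference of two convolutions is a single convolution just at those \<open>t\<close> where both integrals exist.\<close>

proposition Young_inequality_causal_convolution:
  fixes f :: "real \<Rightarrow> 'b::real_normed_vector" and g :: "real \<Rightarrow> 'c::real_normed_vector"
  assumes k: "k \<in> borel_measurable borel" "kernel_mass k (b - a) \<le> ennreal A" "0 < A"
    and f: "strongly_measurable (lebesgue_on {a..b}) f" "Lp_norm p (lebesgue_on {a..b}) f \<le> 1" and p: "1 \<le> p"
    and g: "strongly_measurable (lebesgue_on {a..b}) g"
      "AE t in lebesgue_on {a..b}. ennreal (norm (g t)) \<le> (\<integral>\<^sup>+ s. ennreal \<bar>k (t - s)\<bar> * norm (f s) \<partial>lebesgue_on {a..t})"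
  shows "Lp_norm p (lebesgue_on {a..b}) g \<le> ennreal A"
proof -
  let ?M = "lebesgue_on {a..b}"
  interpret complete_measure ?M by (rule complete_lebesgue_on_Icc)
  have norm_f [measurable]: "(\<lambda>x. norm (f x)) \<in> borel_measurable ?M"
    by (rule borel_measurable_norm_strongly_measurable) fact
  have AE_Icc: "AE t in ?M. t \<in> {a..b}"
    using AE_space[of ?M] by simp
  show ?thesis
  proof (cases "p = \<infinity>")
    case True
    then have f_le: "AE s in ?M. norm (f s) \<le> 1"
      using f(2) AE_norm_le_1_if_Lp_norm_infinity by blast
    have "AE t in ?M. norm (g t) \<le> A"
      using g(2) AE_Icc
    proof eventually_elim
      case (elim t)
      note elim(1)
      also have "(\<integral>\<^sup>+ s. ennreal \<bar>k (t - s)\<bar> * norm (f s) \<partial>lebesgue_on {a..t})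
          \<le> (\<integral>\<^sup>+ s. ennreal \<bar>k (t - s)\<bar> \<partial>lebesgue_on {a..t})"
      proof (rule nn_integral_mono_AE)
        have "AE s in lebesgue_on {a..t}. norm (f s) \<le> 1"
          using AE_lebesgue_on_subinterval[OF f_le] elim(2) by simp
        then show "AE s in lebesgue_on {a..t}. ennreal \<bar>k (t - s)\<bar> * norm (f s) \<le> ennreal \<bar>k (t - s)\<bar>"
        proof eventually_elim
          case (elim s)
          then show ?case
            by (simp add: ennreal_mult[symmetric] mult_left_le)
        qed
      qed
      also have "\<dots> \<le> kernel_mass k (b - a)"
        using elim(2) by (intro nn_integral_reflected_kernel_le k) simp
      also note k(2)
      finally show ?case using k(3) by simp
    qed
    with True show ?thesis
      using Lp_norm_infinity_le[OF g(1)] by simp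
  next
    case False
    let ?q = "enn2real p"
    have q: "1 \<le> ?q" using p False by (rule enn2real_exponent_ge_1)
    have powr_f: "(\<lambda>s. ennreal (norm (f s) powr ?q)) \<in> borel_measurable ?M"
      by measurable
    have "AE t in ?M. ennreal (norm (g t) powr ?q)
        \<le> ennreal (A powr (?q - 1)) * (\<integral>\<^sup>+ s. ennreal \<bar>k (t - s)\<bar> * (norm (f s) powr ?q) \<partial>lebesgue_on {a..t})"
      using g(2) AE_Icc
    proof eventually_elim
      case (elim t)
      show ?case
      proof (rule weighted_power_mean_le[OF _ _ _ _ k(3) _ _ elim(1) q])
        show "(\<lambda>s. \<bar>k (t - s)\<bar>) \<in> borel_measurable (lebesgue_on {a..t})"
          using measurable_reflected_kernel[OF k(1)] by measurable
        show "(\<lambda>s. norm (f s)) \<in> borel_measurable (lebesgue_on {a..t})"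
          using borel_measurable_lebesgue_on_subinterval[OF norm_f] elim(2) by simp
        show "(\<integral>\<^sup>+ s. ennreal \<bar>k (t - s)\<bar> \<partial>lebesgue_on {a..t}) \<le> ennreal A"
          using elim(2) k(2) nn_integral_reflected_kernel_le[OF k(1), of t b a] by simp
      qed auto
    qed
    then have "(\<integral>\<^sup>+ t. ennreal (norm (g t) powr ?q) \<partial>?M) \<le> (\<integral>\<^sup>+ t. ennreal (A powr (?q - 1)) *
        (\<integral>\<^sup>+ s. ennreal \<bar>k (t - s)\<bar> * (norm (f s) powr ?q) \<partial>lebesgue_on {a..t}) \<partial>?M)"
      by (rule nn_integral_mono_AE)
    also have "\<dots> = ennreal (A powr (?q - 1)) *
        (\<integral>\<^sup>+ t. \<integral>\<^sup>+ s. ennreal \<bar>k (t - s)\<bar> * (norm (f s) powr ?q) \<partial>lebesgue_on {a..t} \<partial>?M)"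
      by (intro nn_integral_cmult borel_measurable_causal_convolution k powr_f)
    also have "\<dots> \<le> ennreal (A powr (?q - 1)) * (kernel_mass k (b - a) * (\<integral>\<^sup>+ s. norm (f s) powr ?q \<partial>?M))"
      by (intro mult_left_mono nn_integral_causal_convolution_le k powr_f) simp
    also have "\<dots> \<le> ennreal (A powr (?q - 1)) * (ennreal A * 1)"
      using Lp_norm_le_iff[OF False p, of 1 ?M f] f(2)
      by (intro mult_left_mono mult_mono k) auto
    also have "\<dots> = ennreal (A powr ?q)"
      using k(3) by (simp add: ennreal_mult[symmetric] powr_diff)
    finally show ?thesis
      using k(3) by (subst Lp_norm_le_iff[OF False p]) auto
  qed
qed


section \<open>Continuous dependence of the fractional kernel on its order\<close>

lemma kernel_mass_powr:
  assumes "0 < \<alpha>" "0 \<le> c"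
  shows "kernel_mass (\<lambda>u. u powr (\<alpha> - 1)) c = ennreal (c powr \<alpha> / \<alpha>)"
proof -
  have "((\<lambda>u. u powr (\<alpha> - 1)) has_integral (c powr \<alpha> / \<alpha>)) {0..c}"
    using has_integral_powr_from_0[of "\<alpha> - 1" c] assms by simp
  then show ?thesis
    unfolding kernel_mass_def by (simp add: nn_integral_has_integral_lebesgue')
qed

text \<open>The Riemann--Liouville kernel.\<close>

definition RL_kernel :: "real \<Rightarrow> real \<Rightarrow> real" where
  "RL_kernel \<alpha> u = u powr (\<alpha> - 1) / Gamma \<alpha>"

lemma RL_kernel_measurable [measurable]: "RL_kernel \<alpha> \<in> borel_measurable borel"
  unfolding RL_kernel_def by measurable

lemma tendsto_RL_kernel:
  assumes "(X \<longlongrightarrow> \<alpha>) F" "0 < \<alpha>"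
  shows "((\<lambda>n. RL_kernel (X n) u) \<longlongrightarrow> RL_kernel \<alpha> u) F"
proof (cases "u = 0")
  case False
  have "\<alpha> \<notin> \<int>\<^sub>\<le>\<^sub>0" using assms(2) by (auto elim!: nonpos_Ints_cases)
  with False assms show ?thesis
    unfolding RL_kernel_def
    by (intro tendsto_intros) (auto simp: Gamma_eq_zero_iff)
qed (simp add: RL_kernel_def)

text \<open>Orders are confined to an interval around \<open>\<alpha>\<^sub>0\<close> that stays away from \<open>0\<close>, where \<open>u\<^sup>\<alpha>\<^sup>-\<^sup>1\<close> ceases to
  be integrable.  There one integrable function dominates all kernels: the lower end of the interval
  controls \<open>u \<le> 1\<close>, the upper end \<open>u > 1\<close>.\<close>

proposition tendsto_kernel_mass_RL_kernel_diff:
  assumes "0 < \<alpha>\<^sub>0" "0 \<le> c"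
  shows "((\<lambda>\<alpha>. kernel_mass (\<lambda>u. RL_kernel \<alpha> u - RL_kernel \<alpha>\<^sub>0 u) c) \<longlongrightarrow> 0) (at \<alpha>\<^sub>0)"
proof -
  let ?S = "{\<alpha>\<^sub>0 / 2<..<2 * \<alpha>\<^sub>0}"
  let ?D = "\<lambda>\<alpha> u. ennreal \<bar>RL_kernel \<alpha> u - RL_kernel \<alpha>\<^sub>0 u\<bar> * indicator {0..c} u"
  have "((\<lambda>\<alpha>. kernel_mass (\<lambda>u. RL_kernel \<alpha> u - RL_kernel \<alpha>\<^sub>0 u) c) \<longlongrightarrow> 0) (at \<alpha>\<^sub>0 within ?S)"
    unfolding tendsto_at_iff_sequentially
  proof (intro allI impI)
    fix X assume X: "\<forall>n. X n \<in> ?S - {\<alpha>\<^sub>0}" and lim: "X \<longlonglongrightarrow> \<alpha>\<^sub>0"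
    (* the value of the kernel at 1 is the factor 1 / Gamma (X n) *)
    have "Bseq (\<lambda>n. RL_kernel (X n) 1)"
      by (rule convergent_imp_Bseq[OF convergentI[OF tendsto_RL_kernel[OF lim assms(1)]]])
    then obtain C where C: "0 < C" "\<And>n. norm (RL_kernel (X n) 1) \<le> C"
      by (auto elim: BseqE)
    define w where "w u = C * u powr (\<alpha>\<^sub>0 / 2 - 1) + C * u powr (2 * \<alpha>\<^sub>0 - 1) + RL_kernel \<alpha>\<^sub>0 u" for u
    have kernel_nonneg: "0 \<le> RL_kernel \<alpha> u" if "0 < \<alpha>" for \<alpha> u
      using that by (simp add: RL_kernel_def)
    have bound: "\<bar>RL_kernel (X n) u - RL_kernel \<alpha>\<^sub>0 u\<bar> \<le> w u" if "0 \<le> u" for n u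
    proof -
      have Xn: "\<alpha>\<^sub>0 / 2 < X n" "X n < 2 * \<alpha>\<^sub>0" "0 < X n"
        using X assms(1) by (auto simp: less_trans[of 0 "\<alpha>\<^sub>0 / 2"] dest: spec[of _ n])
      have "u powr (X n - 1) \<le> u powr (\<alpha>\<^sub>0 / 2 - 1) + u powr (2 * \<alpha>\<^sub>0 - 1)"
      proof (cases "u \<le> 1")
        case True
        then have "u powr (X n - 1) \<le> u powr (\<alpha>\<^sub>0 / 2 - 1)"
          using that Xn by (intro powr_mono') auto
        then show ?thesis by (simp add: add_increasing2)
      next
        case False
        then have "u powr (X n - 1) \<le> u powr (2 * \<alpha>\<^sub>0 - 1)"
          using Xn by (intro powr_mono) auto
        then show ?thesis by (simp add: add_increasing)
      qed
      moreover have "0 \<le> RL_kernel (X n) 1" "RL_kernel (X n) 1 \<le> C"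
        using kernel_nonneg[OF Xn(3), of 1] C(2)[of n] by auto
      ultimately have "RL_kernel (X n) 1 * u powr (X n - 1) \<le> C * (u powr (\<alpha>\<^sub>0 / 2 - 1) + u powr (2 * \<alpha>\<^sub>0 - 1))"
        by (intro mult_mono) auto
      moreover have "RL_kernel (X n) u = RL_kernel (X n) 1 * u powr (X n - 1)"
        by (simp add: RL_kernel_def)
      ultimately show ?thesis
        using kernel_nonneg[OF Xn(3), of u] kernel_nonneg[OF assms(1), of u]
        unfolding w_def by (simp add: distrib_left)
    qed
    have "(\<lambda>n. \<integral>\<^sup>+ u. ?D (X n) u \<partial>lborel) \<longlonglongrightarrow> (\<integral>\<^sup>+ (u :: real). 0 \<partial>lborel)"
    proof (rule nn_integral_dominated_convergence[where w = "\<lambda>u. ennreal (w u) * indicator {0..c} u"])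
      show "(\<lambda>u. ennreal (w u) * indicator {0..c} u) \<in> borel_measurable lborel"
        unfolding w_def by measurable
      show "AE u in lborel. ?D (X n) u \<le> ennreal (w u) * indicator {0..c} u" for n
        using bound by (intro AE_I2) (auto simp: indicator_def intro!: ennreal_leI)
      have "(w has_integral (C * (c powr (\<alpha>\<^sub>0 / 2) / (\<alpha>\<^sub>0 / 2)) + C * (c powr (2 * \<alpha>\<^sub>0) / (2 * \<alpha>\<^sub>0))
          + c powr \<alpha>\<^sub>0 / \<alpha>\<^sub>0 / Gamma \<alpha>\<^sub>0)) {0..c}" (is "(w has_integral ?I) _")
        unfolding w_def RL_kernel_def
        using has_integral_powr_from_0[of "\<alpha>\<^sub>0 / 2 - 1" c] has_integral_powr_from_0[of "2 * \<alpha>\<^sub>0 - 1" c]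
          has_integral_powr_from_0[of "\<alpha>\<^sub>0 - 1" c] assms
        by (intro has_integral_add has_integral_mult_right has_integral_divide) simp_all
      then have "(\<integral>\<^sup>+ u. ennreal (w u) * indicator {0..c} u \<partial>lborel) = ennreal ?I"
        using order_trans[OF abs_ge_zero bound] by (intro nn_integral_has_integral_lebesgue') auto
      then show "(\<integral>\<^sup>+ u. ennreal (w u) * indicator {0..c} u \<partial>lborel) < \<infinity>" by simp
      show "AE u in lborel. (\<lambda>n. ?D (X n) u) \<longlonglongrightarrow> 0"
      proof (rule AE_I2)
        fix u
        have "(\<lambda>n. ennreal (\<bar>RL_kernel (X n) u - RL_kernel \<alpha>\<^sub>0 u\<bar> * indicator {0..c} u)) \<longlonglongrightarrow>
            ennreal (\<bar>RL_kernel \<alpha>\<^sub>0 u - RL_kernel \<alpha>\<^sub>0 u\<bar> * indicator {0..c} u)"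
          by (intro tendsto_ennrealI tendsto_intros tendsto_RL_kernel lim assms)
        then show "(\<lambda>n. ?D (X n) u) \<longlonglongrightarrow> 0"
          by (simp add: ennreal_mult ennreal_indicator)
      qed
    qed measurable
    then show "((\<lambda>\<alpha>. kernel_mass (\<lambda>u. RL_kernel \<alpha> u - RL_kernel \<alpha>\<^sub>0 u) c) \<circ> X) \<longlonglongrightarrow> 0"
      by (simp add: kernel_mass_def o_def)
  qed
  then show ?thesis
    using assms(1) by (simp add: at_within_open[of \<alpha>\<^sub>0 ?S])
qed


section \<open>The operator norm\<close>

lemma Lp_opnorm_frac_integral_diff_le:
  assumes "a \<le> b" "0 < \<alpha>" "0 < \<alpha>\<^sub>0" "1 \<le> p" "0 < A"
    and mass: "kernel_mass (\<lambda>u. RL_kernel \<alpha> u - RL_kernel \<alpha>\<^sub>0 u) (b - a) \<le> ennreal A"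
  shows "Lp_opnorm p (lebesgue_on {a..b})
    (\<lambda>(f :: real \<Rightarrow> 'x::banach) t. frac_integral \<alpha> a f t - frac_integral \<alpha>\<^sub>0 a f t) \<le> ennreal A"
  unfolding Lp_opnorm_def
proof (rule SUP_least)
  let ?M = "lebesgue_on {a..b}"
  let ?k = "\<lambda>\<alpha> u :: real. u powr (\<alpha> - 1)"
  fix f :: "real \<Rightarrow> 'x" assume "f \<in> {f \<in> Lp_space p ?M. Lp_norm p ?M f \<le> 1}"
  then have f: "strongly_measurable ?M f" "Lp_norm p ?M f \<le> 1"
    by (auto simp: Lp_space_def)
  interpret complete_measure ?M by (rule complete_lebesgue_on_Icc)
  have f_int: "(\<integral>\<^sup>+ s. norm (f s) \<partial>?M) < \<infinity>"
    by (rule nn_integral_norm_finite_if_Lp_norm_le_1[OF finite_lebesgue_on_Icc f(1) assms(4) f(2)])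
  have norm_f: "(\<lambda>s. ennreal (norm (f s))) \<in> borel_measurable ?M"
    using borel_measurable_norm_strongly_measurable[OF f(1)] by simp
  have mass_fin: "kernel_mass (?k \<alpha>) (b - a) < \<infinity>" "kernel_mass (?k \<alpha>\<^sub>0) (b - a) < \<infinity>"
    using assms(1-3) by (simp_all add: kernel_mass_powr)
  let ?g = "\<lambda>t. frac_integral \<alpha> a f t - frac_integral \<alpha>\<^sub>0 a f t"
  have g_meas: "strongly_measurable ?M ?g"
    unfolding frac_integral_eq_volterra
    by (intro strongly_measurable_diff strongly_measurable_scaleR strongly_measurable_const
        strongly_measurable_volterra mass_fin f f_int) measurable
  have k_meas: "?k \<alpha> \<in> borel_measurable borel" "?k \<alpha>\<^sub>0 \<in> borel_measurable borel"
    by measurable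
  have "AE t in ?M. t \<in> {a..b}" using AE_space[of ?M] by simp
  with AE_causal_convolution_finite[OF k_meas(1) norm_f mass_fin(1) f_int]
    AE_causal_convolution_finite[OF k_meas(2) norm_f mass_fin(2) f_int]
  have "AE t in ?M. ennreal (norm (?g t)) \<le>
      (\<integral>\<^sup>+ s. ennreal \<bar>RL_kernel \<alpha> (t - s) - RL_kernel \<alpha>\<^sub>0 (t - s)\<bar> * norm (f s) \<partial>lebesgue_on {a..t})"
  proof eventually_elim
    case (elim t)
    then have "t \<le> b" by simp
    interpret N: complete_measure "lebesgue_on {a..t}" by (rule complete_lebesgue_on_Icc)
    have int: "has_banach_integral (lebesgue_on {a..t}) (\<lambda>s. (1 / Gamma \<alpha>) *\<^sub>R ((t - s) powr (\<alpha> - 1) *\<^sub>R f s)) (frac_integral \<alpha> a f t)"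
      if "?k \<alpha> \<in> borel_measurable borel"
        "(\<integral>\<^sup>+ s. ennreal \<bar>?k \<alpha> (t - s)\<bar> * norm (f s) \<partial>lebesgue_on {a..t}) < \<infinity>" for \<alpha>
      unfolding frac_integral_eq_volterra
      by (intro N.has_banach_integral_bounded_linear[OF bounded_linear_scaleR_right]
          has_banach_integral_volterra[OF that(1) f(1) \<open>t \<le> b\<close> that(2)])
    have "has_banach_integral (lebesgue_on {a..t})
        (\<lambda>s. (1 / Gamma \<alpha>) *\<^sub>R ((t - s) powr (\<alpha> - 1) *\<^sub>R f s) - (1 / Gamma \<alpha>\<^sub>0) *\<^sub>R ((t - s) powr (\<alpha>\<^sub>0 - 1) *\<^sub>R f s)) (?g t)"
      by (rule N.has_banach_integral_diff[OF int[OF k_meas(1) elim(1)] int[OF k_meas(2) elim(2)]])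
    from N.has_banach_integral_norm_le[OF this] show ?case
      by (simp add: RL_kernel_def ennreal_mult flip: scaleR_diff_left)
  qed
  from Young_inequality_causal_convolution[OF _ mass assms(5) f assms(4) g_meas this]
  have "Lp_norm p ?M ?g \<le> ennreal A" by simp
  moreover from this have "Lp_norm p ?M ?g < \<infinity>"
    by (rule le_less_trans) simp
  ultimately show "(if ?g \<in> Lp_space p ?M then Lp_norm p ?M ?g else \<infinity>) \<le> ennreal A"
    using g_meas by (simp add: Lp_space_def)
qed

theorem theorem23:
  fixes t\<^sub>0 t\<^sub>1 \<alpha>\<^sub>0 :: real and p :: ennreal
  assumes "t\<^sub>0 < t\<^sub>1" and "1 \<le> p" and "\<alpha>\<^sub>0 > 0"
  shows "((\<lambda>\<alpha>. Lp_opnorm p (lebesgue_on {t\<^sub>0..t\<^sub>1})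
             (\<lambda>(f :: real \<Rightarrow> 'x::banach) t.
                frac_integral \<alpha> t\<^sub>0 f t - frac_integral \<alpha>\<^sub>0 t\<^sub>0 f t))
          \<longlongrightarrow> 0) (at \<alpha>\<^sub>0)"
proof (rule order_tendstoI)
  fix e :: ennreal assume "0 < e"
  then obtain A where A: "0 < A" "ennreal A < e"
  proof (cases e)
    case (real r)
    with \<open>0 < e\<close> show ?thesis
      by (intro that[of "r / 2"]) (auto simp: ennreal_less_iff)
  next
    case top
    then show ?thesis by (intro that[of 1]) auto
  qed
  have "\<forall>\<^sub>F \<alpha> in at \<alpha>\<^sub>0. kernel_mass (\<lambda>u. RL_kernel \<alpha> u - RL_kernel \<alpha>\<^sub>0 u) (t\<^sub>1 - t\<^sub>0) < ennreal A"
    using assms A by (intro order_tendstoD(2)[OF tendsto_kernel_mass_RL_kernel_diff]) auto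
  moreover have "\<forall>\<^sub>F \<alpha> in at \<alpha>\<^sub>0. 0 < \<alpha>"
    using assms(3) by (intro order_tendstoD(1)[OF tendsto_ident_at])
  ultimately show "\<forall>\<^sub>F \<alpha> in at \<alpha>\<^sub>0. Lp_opnorm p (lebesgue_on {t\<^sub>0..t\<^sub>1})
      (\<lambda>(f :: real \<Rightarrow> 'x) t. frac_integral \<alpha> t\<^sub>0 f t - frac_integral \<alpha>\<^sub>0 t\<^sub>0 f t) < e"
  proof eventually_elim
    case (elim \<alpha>)
    show ?case
      by (rule le_less_trans[OF Lp_opnorm_frac_integral_diff_le A(2)]) (use elim assms A in auto)
  qed
qed simp

end
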